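(* Let $\{\alpha_j\}_{j=1}^\infty$ be a bounded sequence of complex numbers and $\{\beta_j\}_{j=1}^\infty$ a bounded sequence of positive real numbers. Then there exists a compactly supported symmetric biradial measure $\mu$ on $\mathbb{C}$ such that the Jacobi parameters corresponding to $\mu$ are $\{\alpha_j\}_{j=1}^\infty$, $\{\beta_j\}_{j=1}^\infty$.
   Context: Biradial measures. Write $\mathbb{R}^+=[0,\infty)$. Let $\rho_1^+,\rho_2^+$ be positive Borel measures on $\mathbb{R}^+$ with $\rho_1^+(\mathbb{R}^+)+\rho_2^+(\mathbb{R}^+)=1$, and let $\phi_1,\phi_2:\mathbb{R}^+\to\mathbb{R}$ be Borel measurable. For Borel $E\subset\mathbb{C}$ put $\rho_j(E)=\rho_j^+(\{r\ge0: re^{i\phi_j(r)}\in E\})$, $j=1,2$. The probability measure $\rho=\rho_1+\rho_2$ on $\mathbb{C}$ is called a biradial measure; it is called symmetric if $\phi_1,\phi_2$ can be taken with $\phi_1(r)=\phi_2(r)+\pi$ modulo $2\pi$ for all $r$. Polynomials. For integers $k\ge0$ define the monomials $\langle\lambda\rangle^k=|\lambda|^k$ if $k$ is even and $\langle\lambda\rangle^k=\lambda|\lambda|^{k-1}$ if $k$ is odd. $\mathcal{P}(r2)$ is the complex span of all $\langle\lambda\rangle^k$; the degree of a nonzero element is the largest $k$ for which the coefficient of $\langle\lambda\rangle^k$ is nonzero. Jacobi parameters. Let $\rho$ be a Borel probability measure on $\mathbb{C}$ with $\int|\lambda|^n\,d\rho<\infty$ for all $n\ge0$, and put $\langle p,q\rangle=\int_{\mathbb{C}}p\overline{q}\,d\rho$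 on $\mathcal{P}(r2)$. If the monomials $1,\langle\lambda\rangle^1,\langle\lambda\rangle^2,\dots$ are linearly independent in $L^2(\rho)$, the Gram–Schmidt process applied to them gives orthonormal polynomials $p_0,p_1,p_2,\dots$, $p_j$ of degree $j$ with positive leading coefficient, and these satisfy $$\beta_{j+1}p_{j+1}(\lambda)=\lambda\overline{p_j(\lambda)}-\alpha_{j+1}p_j(\lambda)-\beta_jp_{j-1}(\lambda),\quad j=0,1,2,\dots,$$ with $p_{-1}\equiv0$, $\alpha_{j+1}=\langle\lambda\overline{p_j},p_j\rangle\in\mathbb{C}$ and $\beta_{j+1}=\langle\lambda\overline{p_j},p_{j+1}\rangle>0$. The sequences $\{\alpha_j\}_{j=1}^\infty,\{\beta_j\}_{j=1}^\infty$ are the Jacobi parameters corresponding to $\rho$. Thus the claim includes that the process does not break down for $\mu$. *)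

theory Defs
  imports
    "HOL-Probability.Probability"
    "HOL-Library.Real_Mod"
    "HOL-Computational_Algebra.Polynomial"
begin

abbreviation borel_nonneg :: "real measure" where
  "borel_nonneg \<equiv> restrict_space borel {0..}"

definition biradial_representation ::
    "real measure \<Rightarrow> real measure \<Rightarrow> (real \<Rightarrow> real) \<Rightarrow> (real \<Rightarrow> real) \<Rightarrow> complex measure \<Rightarrow> bool" where
  "biradial_representation \<rho>1 \<rho>2 \<phi>1 \<phi>2 \<rho> \<longleftrightarrow>
     sets \<rho>1 = sets borel_nonneg \<and> sets \<rho>2 = sets borel_nonneg \<and>
     emeasure \<rho>1 {0..} + emeasure \<rho>2 {0..} = 1 \<and>
     \<phi>1 \<in> borel_measurable borel_nonneg \<and> \<phi>2 \<in> borel_measurable borel_nonneg \<and>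
     sets \<rho> = sets borel \<and>
     (\<forall>E \<in> sets borel. emeasure \<rho> E =
        emeasure \<rho>1 {r \<in> {0..}. rcis r (\<phi>1 r) \<in> E} +
        emeasure \<rho>2 {r \<in> {0..}. rcis r (\<phi>2 r) \<in> E})"

definition biradial_measure :: "complex measure \<Rightarrow> bool" where
  "biradial_measure \<rho> \<longleftrightarrow> (\<exists>\<rho>1 \<rho>2 \<phi>1 \<phi>2. biradial_representation \<rho>1 \<rho>2 \<phi>1 \<phi>2 \<rho>)"

definition symmetric_biradial_measure :: "complex measure \<Rightarrow> bool" where
  "symmetric_biradial_measure \<rho> \<longleftrightarrow>
     (\<exists>\<rho>1 \<rho>2 \<phi>1 \<phi>2. biradial_representation \<rho>1 \<rho>2 \<phi>1 \<phi>2 \<rho> \<and>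
        (\<forall>r\<ge>0. [\<phi>1 r = \<phi>2 r + pi] (rmod (2 * pi))))"

definition compactly_supported :: "complex measure \<Rightarrow> bool" where
  "compactly_supported \<rho> \<longleftrightarrow> (\<exists>K. compact K \<and> emeasure \<rho> (- K) = 0)"

definition r2_monom :: "nat \<Rightarrow> complex \<Rightarrow> complex" where
  "r2_monom k z = (if even k then of_real (cmod z ^ k) else z * of_real (cmod z ^ (k - 1)))"

text \<open>
  An element of \<open>P(r2)\<close> is encoded by its coefficients with respect to the monomials
  \<^const>\<open>r2_monom\<close>, stored as a \<^typ>\<open>complex poly\<close>. Only the vector space structure
  and the degree of that type are used, never its multiplication. The encoding is
  faithful by \<open>r2_fun_inject\<close> below.
\<close>

definition r2_fun :: "complex poly \<Rightarrow> complex \<Rightarrow> complex" where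
  "r2_fun p z = (\<Sum>k\<le>degree p. coeff p k * r2_monom k z)"

lemma r2_monom_of_nonneg: "0 \<le> t \<Longrightarrow> r2_monom k (of_real t) = of_real t ^ k"
  by (cases k) (auto simp: r2_monom_def)

lemma r2_fun_of_nonneg: "0 \<le> t \<Longrightarrow> r2_fun p (of_real t) = poly p (of_real t)"
  by (simp add: r2_fun_def r2_monom_of_nonneg poly_altdef)

lemma r2_fun_inject: "r2_fun p = r2_fun q \<longleftrightarrow> p = q"
proof
  assume eq: "r2_fun p = r2_fun q"
  have "complex_of_real ` {0..} \<subseteq> {z. poly (p - q) z = 0}"
    using eq by (auto simp flip: r2_fun_of_nonneg)
  moreover have "infinite (complex_of_real ` {0..})"
    by (simp add: finite_image_iff inj_on_def infinite_Ici)
  ultimately have "infinite {z. poly (p - q) z = 0}"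
    using finite_subset by blast
  then show "p = q"
    using poly_roots_finite[of "p - q"] by auto
qed simp

definition L2_inner :: "complex measure \<Rightarrow> (complex \<Rightarrow> complex) \<Rightarrow> (complex \<Rightarrow> complex) \<Rightarrow> complex" where
  "L2_inner \<rho> f g = (LINT z|\<rho>. f z * cnj (g z))"

definition L2_norm :: "complex measure \<Rightarrow> (complex \<Rightarrow> complex) \<Rightarrow> real" where
  "L2_norm \<rho> f = sqrt (LINT z|\<rho>. (cmod (f z))\<^sup>2)"

definition r2_independent :: "complex measure \<Rightarrow> bool" where
  "r2_independent \<rho> \<longleftrightarrow> (\<forall>p. (AE z in \<rho>. r2_fun p z = 0) \<longrightarrow> p = 0)"

text \<open>
  Meaningful only if all absolute moments of \<open>\<rho>\<close> are finite and \<^term>\<open>r2_independent \<rho>\<close> holds;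
  otherwise the process may divide by zero.
\<close>

function r2_orthonormal :: "complex measure \<Rightarrow> nat \<Rightarrow> complex poly" where
  "r2_orthonormal \<rho> n =
     (let q = monom 1 n -
            (\<Sum>i<n. smult (L2_inner \<rho> (r2_monom n) (r2_fun (r2_orthonormal \<rho> i))) (r2_orthonormal \<rho> i))
      in smult (of_real (1 / L2_norm \<rho> (r2_fun q))) q)"
  by auto
termination
  by (relation "Wellfounded.measure snd") auto

declare r2_orthonormal.simps [simp del]

text \<open>The entries \<open>\<alpha> 0\<close> and \<open>\<beta> 0\<close> are irrelevant: the parameter sequences are indexed from 1.\<close>

definition has_Jacobi_parameters ::
    "complex measure \<Rightarrow> (nat \<Rightarrow> complex) \<Rightarrow> (nat \<Rightarrow> real) \<Rightarrow> bool" where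
  "has_Jacobi_parameters \<rho> \<alpha> \<beta> \<longleftrightarrow>
     prob_space \<rho> \<and> sets \<rho> = sets borel \<and>
     (\<forall>n. integrable \<rho> (\<lambda>z. cmod z ^ n)) \<and>
     r2_independent \<rho> \<and>
     (let p = (\<lambda>j. r2_fun (r2_orthonormal \<rho> j)) in
        \<forall>j. \<alpha> (j + 1) = L2_inner \<rho> (\<lambda>z. z * cnj (p j z)) (p j) \<and>
            of_real (\<beta> (j + 1)) = L2_inner \<rho> (\<lambda>z. z * cnj (p j z)) (p (j + 1)) \<and>
            (\<forall>z. of_real (\<beta> (j + 1)) * p (j + 1) z =
                   z * cnj (p j z) - \<alpha> (j + 1) * p j z -
                   (if j = 0 then 0 else of_real (\<beta> j) * p (j - 1) z)))"

end

theory Submission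
  imports Defs
begin

text \<open>
  The recursion says that \<open>A f = \<lambda> * cnj f\<close> acts on the coordinates with respect to
  \<open>p\<^sub>0, p\<^sub>1, \<dots>\<close> by the complex symmetric Jacobi matrix followed by complex conjugation. This
  antilinear operator is bounded and symmetric for the real inner product
  \<open>Re \<langle>f, g\<rangle>\<close>. Hence for each unit vector \<open>w e\<^sub>0\<close> the real moment
  problem for \<open>Re \<langle>A\<^sup>k w e\<^sub>0, w e\<^sub>0\<rangle>\<close> has a solution on a compact interval. The even moments do not
  depend on \<open>w\<close> and give the distribution of the squared radius; the odd ones are the moments of
  \<open>Re (z h)\<close>, \<open>z = (cnj w)\<^sup>2\<close>, for one complex function \<open>h\<close> of the squared radius. Letting \<open>w\<close>
  vary shows that \<open>\<bar>h\<bar>\<close> is at most the radius, so \<open>h\<close> is the barycentre of two masses at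
  opposite points of each circle, which is a symmetric biradial measure with the required moments.
  Orthonormality of the \<open>p\<^sub>j\<close> follows as in Favard's theorem.
\<close>

section \<open>The moment problem on a compact interval\<close>

text \<open>On the circle of radius r every element of P(r2) is an affine function of lambda, so a
  measure enters the inner products only through its radial law and its barycentre on each circle;
  two opposite points realise every barycentre of modulus at most r. Hence it suffices to match the
  integrals of all monomials, the numbers <A^k e_0, e_0>. As A is only antilinear, the complex
  spectral theorem does not apply to it directly, and with Re <f, g> a single vector reveals only
  the real parts of the odd moments. Passing from e_0 to w e_0 rotates these moments and so exposes
  both parts. The interval has radius at least a + 2 b: a bounds the diagonal of the matrix, b each
  of the two off-diagonals.\<close>

lemma borel_measurable_poly [measurable]: "poly (p :: real poly) \<in> borel_measurable borel"
  by (intro borel_measurable_continuous_onI continuous_intros)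

text \<open>The ratio is the product of (k - i) / (n - i) over i < m. All factors have modulus at
  most 1 and differ from k / n by at most m / (n - m), and the differences of m such factors add
  up.\<close>

lemma binomial_ratio_approx:
  assumes "2 * m \<le> n" "0 < n" "k \<le> n"
  shows "\<bar>real (k choose m) / real (n choose m) - (real k / real n) ^ m\<bar> \<le> real m * (real m / real (n - m))"
proof -
  let ?f = "\<lambda>i. (real k - real i) / (real n - real i)"
  have "real (k choose m) / real (n choose m) = (\<Prod>i=0..<m. ?f i)"
    by (simp add: binomial_gbinomial gbinomial_prod_rev prod_dividef)
  moreover have "(real k / real n) ^ m = (\<Prod>i=0..<m. real k / real n)"
    by simp
  moreover have "norm ((\<Prod>i=0..<m. ?f i) - (\<Prod>i=0..<m. real k / real n)) \<le> (\<Sum>i=0..<m. norm (?f i - real k / real n))"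
  proof (rule norm_prod_diff)
    fix i assume "i \<in> {0..<m}"
    \<comment> \<open>For k < i the numerator is negative; its modulus i - k is still at most n - i
      because 2 i \<le> n.\<close>
    then have "\<bar>real k - real i\<bar> \<le> real n - real i" "0 < real n - real i"
      using assms by auto
    then show "norm (?f i) \<le> 1"
      by (simp add: field_simps abs_le_iff)
    show "norm (real k / real n) \<le> 1"
      using assms by simp
  qed
  moreover have "(\<Sum>i=0..<m. norm (?f i - real k / real n)) \<le> (\<Sum>i=0..<m. real m / real (n - m))"
  proof (rule sum_mono)
    fix i assume i: "i \<in> {0..<m}"
    have nz: "0 < real n - real i" "0 < real n" "0 < real (n - m)"
      using i assms by auto
    have "?f i - real k / real n = - (real i * (real n - real k) / (real n * (real n - real i)))"
      using nz by (simp add: field_simps)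
    then have "norm (?f i - real k / real n) = \<bar>real i * (real n - real k) / (real n * (real n - real i))\<bar>"
      by simp
    also have "\<dots> = (real i * (real n - real k)) / (real n * (real n - real i))"
      using nz assms by simp
    also have "\<dots> \<le> (real m * real n) / (real n * real (n - m))"
      using nz i assms by (intro frac_le mult_mono) auto
    also have "\<dots> = real m / real (n - m)"
      using nz by simp
    finally show "norm (?f i - real k / real n) \<le> real m / real (n - m)" .
  qed
  ultimately show ?thesis
    by simp
qed

lemma smult_sum_right: "smult c (sum f S) = (\<Sum>i\<in>S. smult c (f i))"
  by (induction S rule: infinite_finite_induct) (auto simp: smult_add_right)

text \<open>The factorial moments of the binomial distribution, as a polynomial identity. Counting
  pairs of nested subsets extracts (n choose m) X^m, and the binomial theorem turns the rest into a
  power of X + (1 - X) = 1.\<close>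

lemma sum_choose_Bernstein_poly:
  fixes m n :: nat
  assumes "m \<le> n"
  shows "(\<Sum>k\<le>n. smult (real (k choose m)) (smult (real (n choose k)) ([:0,1:] ^ k * [:1,-1:] ^ (n - k))))
         = smult (real (n choose m)) ([:0,1:] ^ m)"
proof -
  let ?X = "[:0,1:] :: real poly" and ?Y = "[:1,-1:] :: real poly"
  have "(\<Sum>k\<le>n. smult (real (k choose m)) (smult (real (n choose k)) (?X ^ k * ?Y ^ (n - k))))
      = (\<Sum>k=m..n. smult (real (k choose m)) (smult (real (n choose k)) (?X ^ k * ?Y ^ (n - k))))"
    by (rule sum.mono_neutral_right) (auto simp: not_le)
  also have "\<dots> = (\<Sum>k=m..n. smult (real (n choose m)) (?X ^ m * (of_nat ((n - m) choose (k - m)) * ?X ^ (k - m) * ?Y ^ (n - k))))"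
  proof (rule sum.cong)
    fix k assume k: "k \<in> {m..n}"
    then have "(n choose k) * (k choose m) = (n choose m) * ((n - m) choose (k - m))"
      by (simp add: choose_mult)
    then have c: "real (k choose m) * real (n choose k) = real (n choose m) * real ((n - m) choose (k - m))"
      by (metis mult.commute of_nat_mult)
    have x: "?X ^ k = ?X ^ m * ?X ^ (k - m)"
      using k by (simp flip: power_add)
    show "smult (real (k choose m)) (smult (real (n choose k)) (?X ^ k * ?Y ^ (n - k)))
        = smult (real (n choose m)) (?X ^ m * (of_nat ((n - m) choose (k - m)) * ?X ^ (k - m) * ?Y ^ (n - k)))"
      unfolding x by (simp add: c of_nat_poly mult.assoc)
  qed simp
  also have "\<dots> = smult (real (n choose m)) (?X ^ m * (\<Sum>k=m..n. of_nat ((n - m) choose (k - m)) * ?X ^ (k - m) * ?Y ^ (n - k)))"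
    by (simp add: sum_distrib_left smult_sum_right)
  also have "(\<Sum>k=m..n. of_nat ((n - m) choose (k - m)) * ?X ^ (k - m) * ?Y ^ (n - k))
      = (\<Sum>k\<le>n - m. of_nat ((n - m) choose k) * ?X ^ k * ?Y ^ (n - m - k))"
    by (rule sum.reindex_bij_witness[of _ "\<lambda>k. k + m" "\<lambda>k. k - m"]) (use assms in auto)
  also have "\<dots> = (?X + ?Y) ^ (n - m)"
    by (simp only: binomial_ring)
  also have "?X + ?Y = 1"
    by (simp add: one_pCons)
  finally show ?thesis
    by simp
qed

text \<open>All measures live on [0,1], hence are tight, and a subsequence converges weakly. Weak
  convergence sees only bounded continuous functions, so support and powers are tested through
  suitable clamped functions.\<close>

lemma prob_on_unit_interval_limit:
  fixes \<mu> :: "nat \<Rightarrow> real measure"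
  assumes \<mu>: "\<And>n. real_distribution (\<mu> n)" and unit: "\<And>n. AE x in \<mu> n. x \<in> {0..1}"
    and lim: "\<And>m. (\<lambda>n. \<integral>x. x ^ m \<partial>\<mu> n) \<longlonglongrightarrow> c m"
  shows "\<exists>\<tau>. real_distribution \<tau> \<and> (AE x in \<tau>. x \<in> {0..1}) \<and> (\<forall>m. (\<integral>x. x ^ m \<partial>\<tau>) = c m)"
proof -
  have "tight \<mu>"
    unfolding tight_def
  proof (intro conjI allI impI)
    fix \<epsilon> :: real assume "0 < \<epsilon>"
    have "1 - \<epsilon> < measure (\<mu> n) {-1<..2}" for n
    proof -
      interpret real_distribution "\<mu> n" by (rule \<mu>)
      have "prob {-1<..2} = 1"
        using unit[of n] by (subst prob_eq_1) auto
      then show ?thesis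
        using \<open>0 < \<epsilon>\<close> by simp
    qed
    then show "\<exists>a b. a < b \<and> (\<forall>n. 1 - \<epsilon> < measure (\<mu> n) {a<..b})"
      by (intro exI[of _ "-1"] exI[of _ 2]) auto
  qed (rule \<mu>)
  from tight_imp_convergent_subsubsequence[OF this strict_mono_id] obtain r \<tau>
    where r: "strict_mono (r :: nat \<Rightarrow> nat)" and \<tau>: "real_distribution \<tau>" and w: "weak_conv_m (\<mu> \<circ> r) \<tau>"
    by auto
  interpret \<tau>: real_distribution \<tau> by fact
  have \<mu>r: "real_distribution ((\<mu> \<circ> r) n)" for n
    by (simp add: \<mu>)
  \<comment> \<open>Continuous, bounded by 1 and zero exactly on [0,1]: its vanishing integral
    survives the limit and confines \<tau> to [0,1].\<close>
  define g where "g x = min 1 (max 0 (max (- x) (x - 1)))" for x :: real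
  have conv_g: "(\<lambda>n. integral\<^sup>L ((\<mu> \<circ> r) n) g) \<longlonglongrightarrow> integral\<^sup>L \<tau> g"
  proof (rule weak_conv_imp_integral_bdd_continuous_conv[OF \<mu>r \<tau> w, where B = 1])
    have "continuous_on UNIV g"
      unfolding g_def by (intro continuous_intros)
    then show "isCont g x" for x
      by (simp add: continuous_on_eq_continuous_at)
  qed (auto simp: g_def)
  have "integral\<^sup>L ((\<mu> \<circ> r) n) g = 0" for n
  proof (rule integral_eq_zero_AE)
    show "AE x in (\<mu> \<circ> r) n. g x = 0"
      unfolding o_def using unit[of "r n"] by eventually_elim (auto simp: g_def)
  qed
  with conv_g have "integral\<^sup>L \<tau> g = 0"
    using LIMSEQ_unique tendsto_const by (metis (no_types, lifting) ext)
  moreover have [measurable]: "g \<in> borel_measurable borel"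
    unfolding g_def by measurable
  have "integrable \<tau> g"
    by (rule \<tau>.integrable_const_bound[where B = 1]) (auto simp: g_def)
  ultimately have "AE x in \<tau>. g x = 0"
    by (subst (asm) integral_nonneg_eq_0_iff_AE) (auto simp: g_def)
  then have AE\<tau>: "AE x in \<tau>. x \<in> {0..1}"
    by eventually_elim (auto simp: g_def min_def max_def split: if_splits)
  have "(\<integral>x. x ^ m \<partial>\<tau>) = c m" for m
  proof -
    define h where "h x = (max 0 (min 1 x)) ^ m" for x :: real
    have hm [measurable]: "h \<in> borel_measurable borel"
      unfolding h_def by measurable
    have h: "h x = x ^ m" if "x \<in> {0..1}" for x
      using that by (auto simp: h_def min_def max_def)
    have "(\<lambda>n. integral\<^sup>L ((\<mu> \<circ> r) n) h) \<longlonglongrightarrow> integral\<^sup>L \<tau> h"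
    proof (rule weak_conv_imp_integral_bdd_continuous_conv[OF \<mu>r \<tau> w, where B = 1])
      have "continuous_on UNIV h"
        unfolding h_def by (intro continuous_intros)
      then show "isCont h x" for x
        by (simp add: continuous_on_eq_continuous_at)
    qed (auto simp: h_def power_le_one)
    moreover have "integral\<^sup>L ((\<mu> \<circ> r) n) h = (\<integral>x. x ^ m \<partial>\<mu> (r n))" for n
    proof -
      interpret real_distribution "\<mu> (r n)" by (rule \<mu>)
      show ?thesis
        using unit[of "r n"] by (auto intro!: integral_cong_AE simp: h)
    qed
    moreover have "integral\<^sup>L \<tau> h = (\<integral>x. x ^ m \<partial>\<tau>)"
      using AE\<tau> by (auto intro!: integral_cong_AE simp: h)
    moreover have "(\<lambda>n. \<integral>x. x ^ m \<partial>\<mu> (r n)) \<longlonglongrightarrow> c m"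
      using LIMSEQ_subseq_LIMSEQ[OF lim r] by (simp add: o_def)
    ultimately show ?thesis
      using LIMSEQ_unique by (metis (no_types, lifting) ext)
  qed
  with \<tau> AE\<tau> show ?thesis
    by blast
qed

lemma poly_functional_sum:
  fixes L :: "real poly \<Rightarrow> real"
  assumes add: "\<And>p q. L (p + q) = L p + L q" and smult: "\<And>c p. L (smult c p) = c * L p"
  shows "L (\<Sum>i\<in>I. smult (c i) (p i)) = (\<Sum>i\<in>I. c i * L (p i))"
proof -
  have "L 0 = 0"
    using smult[of 0 0] by simp
  then show ?thesis
    by (induction I rule: infinite_finite_induct) (auto simp: add smult)
qed

text \<open>Hausdorff's moment problem, by Bernstein's discretisation. The hypotheses make
  \<open>L\<close> nonnegative on all X^i (1 - X)^j, so its values on the Bernstein polynomials of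
  degree n are probability weights. Their averages of (k choose m) / (n choose m) equal L (X^m)
  exactly; replacing that ratio by (k / n)^m costs an error that vanishes in the limit.\<close>

lemma unit_interval_moment_problem:
  fixes L :: "real poly \<Rightarrow> real"
  assumes add: "\<And>p q. L (p + q) = L p + L q" and smult: "\<And>c p. L (smult c p) = c * L p"
    and one: "L 1 = 1"
    and pos0: "\<And>p. 0 \<le> L ([:0,1:] * p\<^sup>2)" and pos1: "\<And>p. 0 \<le> L ([:1,-1:] * p\<^sup>2)"
  shows "\<exists>\<tau>. real_distribution \<tau> \<and> (AE x in \<tau>. x \<in> {0..1}) \<and> (\<forall>m. (\<integral>x. x ^ m \<partial>\<tau>) = L ([:0,1:] ^ m))"
proof -
  let ?X = "[:0,1:] :: real poly" and ?Y = "[:1,-1:] :: real poly"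
  have XY: "?X + ?Y = 1"
    by (simp add: one_pCons)
  have pos: "0 \<le> L (p\<^sup>2)" for p
  proof -
    have "L ((?X + ?Y) * p\<^sup>2) = L (?X * p\<^sup>2) + L (?Y * p\<^sup>2)"
      by (simp only: distrib_right add)
    then have "L (p\<^sup>2) = L (?X * p\<^sup>2) + L (?Y * p\<^sup>2)"
      by (simp only: XY mult_1)
    then show ?thesis
      using pos0[of p] pos1[of p] by simp
  qed
  have pos01: "0 \<le> L (?X * (?Y * p\<^sup>2))" for p
  proof -
    \<comment> \<open>Since X + Y = 1, the product X Y equals X^2 Y + X Y^2, a sum of the two types
      covered by the hypotheses.\<close>
    have "(?X + ?Y) * (?X * (?Y * p\<^sup>2)) = ?Y * (?X * p)\<^sup>2 + ?X * (?Y * p)\<^sup>2"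
      by (simp only: ring_distribs power2_eq_square mult_ac)
    then have "L (?X * (?Y * p\<^sup>2)) = L (?Y * (?X * p)\<^sup>2) + L (?X * (?Y * p)\<^sup>2)"
      by (simp only: add XY mult_1)
    then show ?thesis
      using pos1[of "?X * p"] pos0[of "?Y * p"] by linarith
  qed
  have posB: "0 \<le> L (?X ^ i * ?Y ^ j)" for i j
  proof -
    \<comment> \<open>The even parts of the exponents form a square; the parities leave the four
      prefactors 1, X, Y and X Y.\<close>
    have "\<exists>i' i'' j' j''. i = i' + 2 * i'' \<and> j = j' + 2 * j'' \<and> i' < 2 \<and> j' < 2"
      by (intro exI[of _ "i mod 2"] exI[of _ "i div 2"] exI[of _ "j mod 2"] exI[of _ "j div 2"]) auto
    then obtain i' i'' j' j'' where ij: "i = i' + 2 * i''" "j = j' + 2 * j''" "i' < 2" "j' < 2"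
      by blast
    have eq: "?X ^ i * ?Y ^ j = ?X ^ i' * (?Y ^ j' * (?X ^ i'' * ?Y ^ j'')\<^sup>2)"
      unfolding ij by (simp only: power_add power_mult power_mult_distrib power2_eq_square mult_ac)
    show ?thesis
      unfolding eq using ij(3,4) pos[of "?X ^ i'' * ?Y ^ j''"] pos0[of "?X ^ i'' * ?Y ^ j''"]
        pos1[of "?X ^ i'' * ?Y ^ j''"] pos01[of "?X ^ i'' * ?Y ^ j''"]
      by (auto simp only: less_2_cases_iff power_0 power_Suc mult_1_left mult_1_right)
  qed
  \<comment> \<open>Apply \<open>L\<close> to the Bernstein polynomials and place the resulting weights at the points \<open>k / n\<close>.\<close>
  define w where "w n k = L (smult (real (n choose k)) (?X ^ k * ?Y ^ (n - k)))" for n k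
  have w_nonneg: "0 \<le> w n k" for n k
    by (simp add: w_def smult posB del: mult_pCons_left power_Suc)
  have w_choose: "(\<Sum>k\<le>n. real (k choose m) / real (n choose m) * w n k) = L (?X ^ m)" if "m \<le> n" for m n
  proof -
    have "(\<Sum>k\<le>n. real (k choose m) * w n k) = real (n choose m) * L (?X ^ m)"
      unfolding w_def poly_functional_sum[of L, OF add smult, symmetric] sum_choose_Bernstein_poly[OF that]
      by (simp add: smult)
    then show ?thesis
      using that by (simp add: sum_divide_distrib[symmetric] field_simps)
  qed
  have w_sum: "(\<Sum>k\<le>n. w n k) = 1" for n
    using w_choose[of 0 n] one by simp
  define \<mu> where "\<mu> n = distr (point_measure {..n} (\<lambda>k. ennreal (w n k))) borel (\<lambda>k. real k / real n)" for n
  have int_\<mu>: "(\<integral>x. f x \<partial>\<mu> n) = (\<Sum>k\<le>n. w n k * f (real k / real n))"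
    if [measurable]: "f \<in> borel_measurable borel" for f :: "real \<Rightarrow> real" and n
    unfolding \<mu>_def using w_nonneg
    by (subst integral_distr) (simp_all add: lebesgue_integral_point_measure_finite measurable_point_measure_eq1)
  have \<mu>: "real_distribution (\<mu> n)" for n
  proof -
    have "prob_space (point_measure {..n} (\<lambda>k. ennreal (w n k)))"
      by (rule prob_spaceI) (simp add: emeasure_point_measure_finite sum_ennreal w_nonneg w_sum space_point_measure)
    then have "prob_space (\<mu> n)"
      unfolding \<mu>_def by (rule prob_space.prob_space_distr) (simp add: point_measure_def)
    then show ?thesis
      by (simp add: real_distribution_def real_distribution_axioms_def \<mu>_def)
  qed
  have unit: "AE x in \<mu> n. x \<in> {0..1}" for n
    unfolding \<mu>_def
    by (subst AE_distr_iff) (auto simp: point_measure_def divide_le_eq_1 intro!: AE_I2)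
  have lim: "(\<lambda>n. \<integral>x. x ^ m \<partial>\<mu> n) \<longlonglongrightarrow> L (?X ^ m)" for m
  proof (rule Lim_null[THEN iffD2], rule Lim_null_comparison)
    show "(\<lambda>n. real m * (real m / real (n - m))) \<longlonglongrightarrow> 0"
      by real_asymp
    show "\<forall>\<^sub>F n in sequentially. norm ((\<integral>x. x ^ m \<partial>\<mu> n) - L (?X ^ m)) \<le> real m * (real m / real (n - m))"
      using eventually_ge_at_top[of "2 * m + 1"]
    proof eventually_elim
      case (elim n)
      have "(\<integral>x. x ^ m \<partial>\<mu> n) - L (?X ^ m)
          = (\<Sum>k\<le>n. w n k * (real k / real n) ^ m) - (\<Sum>k\<le>n. real (k choose m) / real (n choose m) * w n k)"
        using elim by (subst w_choose) (auto simp: int_\<mu>)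
      also have "\<dots> = (\<Sum>k\<le>n. w n k * ((real k / real n) ^ m - real (k choose m) / real (n choose m)))"
        by (simp add: sum_subtractf algebra_simps)
      also have "norm \<dots> \<le> (\<Sum>k\<le>n. w n k * (real m * (real m / real (n - m))))"
      proof (intro sum_norm_le)
        fix k assume "k \<in> {..n}"
        then have "\<bar>(real k / real n) ^ m - real (k choose m) / real (n choose m)\<bar> \<le> real m * (real m / real (n - m))"
          using binomial_ratio_approx[of m n k] elim by (simp add: abs_minus_commute)
        then show "norm (w n k * ((real k / real n) ^ m - real (k choose m) / real (n choose m))) \<le> w n k * (real m * (real m / real (n - m)))"
          using w_nonneg[of n k] by (simp only: real_norm_def abs_mult abs_of_nonneg mult_left_mono)
      qed
      also have "\<dots> = real m * (real m / real (n - m))"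
        by (simp only: sum_distrib_right[symmetric] w_sum mult_1_left)
      finally show ?case .
    qed
  qed
  show ?thesis
    by (rule prob_on_unit_interval_limit[OF \<mu> unit lim])
qed

text \<open>Transport along the affine bijection \<open>?\<phi>\<close> from [-M, M] to [0,1] with
  inverse \<open>?\<psi>\<close>: polynomials are composed with the former, the measure is pushed
  forward by the latter.\<close>

lemma interval_moment_problem:
  fixes L :: "real poly \<Rightarrow> real"
  assumes add: "\<And>p q. L (p + q) = L p + L q" and smult: "\<And>c p. L (smult c p) = c * L p"
    and one: "L 1 = 1" and M: "0 < M"
    and pos0: "\<And>p. 0 \<le> L ([:M,1:] * p\<^sup>2)" and pos1: "\<And>p. 0 \<le> L ([:M,-1:] * p\<^sup>2)"
  shows "\<exists>\<tau>. real_distribution \<tau> \<and> (AE x in \<tau>. x \<in> {-M..M}) \<and> (\<forall>p. (\<integral>x. poly p x \<partial>\<tau>) = L p)"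
proof -
  let ?\<phi> = "[:1 / 2, 1 / (2 * M):]" and ?\<psi> = "[:- M, 2 * M:]"
  define L' where "L' p = L (p \<circ>\<^sub>p ?\<phi>)" for p
  have "\<exists>\<tau>. real_distribution \<tau> \<and> (AE x in \<tau>. x \<in> {0..1}) \<and> (\<forall>m. (\<integral>x. x ^ m \<partial>\<tau>) = L' ([:0,1:] ^ m))"
  proof (rule unit_interval_moment_problem)
    fix p q :: "real poly" and c :: real
    show "L' (p + q) = L' p + L' q" "L' (smult c p) = c * L' p"
      by (simp_all add: L'_def pcompose_add pcompose_smult add smult)
    show "L' 1 = 1"
      by (simp add: L'_def pcompose_1 one)
    have "[:0,1:] \<circ>\<^sub>p ?\<phi> = smult (1 / (2 * M)) [:M,1:]"
      using M by (simp add: pcompose_pCons)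
    then have "([:0,1:] * p\<^sup>2) \<circ>\<^sub>p ?\<phi> = smult (1 / (2 * M)) ([:M,1:] * (p \<circ>\<^sub>p ?\<phi>)\<^sup>2)"
      by (simp only: pcompose_mult power2_eq_square mult_smult_left)
    then show "0 \<le> L' ([:0,1:] * p\<^sup>2)"
      using M pos0[of "p \<circ>\<^sub>p ?\<phi>"] by (simp add: L'_def smult del: mult_pCons_left)
    have "[:1,-1:] \<circ>\<^sub>p ?\<phi> = smult (1 / (2 * M)) [:M,-1:]"
      using M by (simp add: pcompose_pCons)
    then have "([:1,-1:] * p\<^sup>2) \<circ>\<^sub>p ?\<phi> = smult (1 / (2 * M)) ([:M,-1:] * (p \<circ>\<^sub>p ?\<phi>)\<^sup>2)"
      by (simp only: pcompose_mult power2_eq_square mult_smult_left)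
    then show "0 \<le> L' ([:1,-1:] * p\<^sup>2)"
      using M pos1[of "p \<circ>\<^sub>p ?\<phi>"] by (simp add: L'_def smult del: mult_pCons_left)
  qed
  then obtain \<sigma> where \<sigma>: "real_distribution \<sigma>" and unit: "AE x in \<sigma>. x \<in> {0..1}"
    and mom: "\<And>m. (\<integral>x. x ^ m \<partial>\<sigma>) = L' ([:0,1:] ^ m)"
    by blast
  interpret \<sigma>: real_distribution \<sigma> by fact
  have int: "integrable \<sigma> (\<lambda>x. x ^ m)" for m
  proof (rule \<sigma>.integrable_const_bound[where B = 1])
    show "AE x in \<sigma>. norm (x ^ m) \<le> 1"
      using unit by eventually_elim (auto simp: power_le_one)
  qed simp
  have mom': "(\<integral>x. poly p x \<partial>\<sigma>) = L' p" for p
  proof -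
    have "L' p = (\<Sum>i\<le>degree p. coeff p i * L' ([:0,1:] ^ i))"
    proof -
      have "p = (\<Sum>i\<le>degree p. smult (coeff p i) ([:0,1:] ^ i))"
        using poly_as_sum_of_monoms[of p] by (simp add: monom_altdef)
      then have "L' p = L' (\<Sum>i\<le>degree p. smult (coeff p i) ([:0,1:] ^ i))"
        by simp
      also have "\<dots> = (\<Sum>i\<le>degree p. coeff p i * L' ([:0,1:] ^ i))"
        by (rule poly_functional_sum) (simp_all add: L'_def pcompose_add pcompose_smult add smult)
      finally show ?thesis .
    qed
    then show ?thesis
      by (simp add: poly_altdef int mom)
  qed
  define \<tau> where "\<tau> = distr \<sigma> borel (poly ?\<psi>)"
  have "real_distribution \<tau>"
    unfolding \<tau>_def by (rule \<sigma>.real_distribution_distr) simp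
  moreover have "AE x in \<tau>. x \<in> {-M..M}"
    unfolding \<tau>_def
  proof (subst AE_distr_iff)
    show "AE x in \<sigma>. poly ?\<psi> x \<in> {-M..M}"
      using unit by eventually_elim (use M in auto)
  qed auto
  moreover have "(\<integral>x. poly p x \<partial>\<tau>) = L p" for p
  proof -
    have "(\<integral>x. poly p x \<partial>\<tau>) = (\<integral>x. poly p (poly ?\<psi> x) \<partial>\<sigma>)"
      unfolding \<tau>_def by (subst integral_distr) auto
    also have "\<dots> = (\<integral>x. poly (p \<circ>\<^sub>p ?\<psi>) x \<partial>\<sigma>)"
      by (simp only: poly_pcompose)
    also have "\<dots> = L (p \<circ>\<^sub>p (?\<psi> \<circ>\<^sub>p ?\<phi>))"
      by (simp add: mom' L'_def pcompose_assoc)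
    also have "?\<psi> \<circ>\<^sub>p ?\<phi> = [:0,1:]"
      using M by (simp add: pcompose_pCons)
    finally show ?thesis
      by (simp add: pcompose_idR)
  qed
  ultimately show ?thesis
    by blast
qed

section \<open>Determinacy\<close>

text \<open>The continuous ramp is 1 up to x and 0 from y on, hence lies between two indicators.
  Integrals of continuous functions thereby control distribution functions.\<close>

lemma (in finite_borel_measure) cdf_cts_step:
  assumes [arith]: "x < y"
  shows "cdf M x \<le> integral\<^sup>L M (cts_step x y)" and "integral\<^sup>L M (cts_step x y) \<le> cdf M y"
proof -
  have meas: "cts_step x y \<in> borel_measurable M"
    using borel_measurable_continuous_onI[OF uniformly_continuous_imp_continuous[OF cts_step_uniformly_continuous[OF assms]]]
    by (simp add: M_is_borel cong: measurable_cong_sets)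
  have int: "integrable M (cts_step x y)"
    by (rule integrable_const_bound[of _ 1]) (auto simp: cts_step_def meas)
  have "cdf M x = integral\<^sup>L M (indicator {..x})"
    by (simp add: cdf_def borel_UNIV)
  also have "\<dots> \<le> integral\<^sup>L M (cts_step x y)"
    by (intro integral_mono int)
      (auto simp: cts_step_def emeasure_eq_measure M_is_borel split: split_indicator)
  finally show "cdf M x \<le> integral\<^sup>L M (cts_step x y)" .
  have "integral\<^sup>L M (cts_step x y) \<le> integral\<^sup>L M (indicator {..y})"
    by (intro integral_mono int)
      (auto simp: cts_step_def emeasure_eq_measure M_is_borel split: split_indicator)
  also have "\<dots> = cdf M y"
    by (simp add: cdf_def borel_UNIV)
  finally show "integral\<^sup>L M (cts_step x y) \<le> cdf M y" .
qed

text \<open>The ramp from x to y compares the value of one function at x with that of the other at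
  y; right continuity lets y decrease to x.\<close>

lemma cdf_le_if_cts_step_eq:
  assumes "finite_borel_measure M" "finite_borel_measure N"
    and eq: "\<And>x y. x < y \<Longrightarrow> integral\<^sup>L M (cts_step x y) = integral\<^sup>L N (cts_step x y)"
  shows "cdf M x \<le> cdf N x"
proof (rule tendsto_lowerbound)
  interpret M: finite_borel_measure M by fact
  interpret N: finite_borel_measure N by fact
  show "(cdf N \<longlongrightarrow> cdf N x) (at_right x)"
    using N.cdf_is_right_cont by (simp add: continuous_within)
  have "cdf M x \<le> cdf N y" if "x < y" for y
    using M.cdf_cts_step(1)[OF that] N.cdf_cts_step(2)[OF that] eq[OF that] by simp
  then show "\<forall>\<^sub>F y in at_right x. cdf M x \<le> cdf N y"
    by (auto simp: eventually_at_filter)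
qed simp

lemma (in finite_measure) integral_uniform_approx:
  fixes f g :: "'a \<Rightarrow> real"
  assumes "integrable M f" "integrable M g" "AE x in M. \<bar>f x - g x\<bar> \<le> e" "0 \<le> e"
  shows "\<bar>integral\<^sup>L M f - integral\<^sup>L M g\<bar> \<le> e * measure M (space M)"
proof -
  have "\<bar>integral\<^sup>L M f - integral\<^sup>L M g\<bar> = norm (\<integral>x. f x - g x \<partial>M)"
    using assms by simp
  also have "\<dots> \<le> (\<integral>x. norm (f x - g x) \<partial>M)"
    by (rule integral_norm_bound)
  also have "\<dots> \<le> (\<integral>x. e \<partial>M)"
    using assms by (intro integral_mono_AE integrable_norm) auto
  finally show ?thesis
    by (simp add: mult.commute)
qed

lemma (in finite_borel_measure) integrable_continuous_AE_Icc:
  fixes f :: "real \<Rightarrow> real"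
  assumes AE: "AE x in M. x \<in> {a..b}" and f: "continuous_on UNIV f"
  shows "integrable M f"
proof -
  have "bounded (f ` {a..b})"
    by (intro compact_imp_bounded compact_continuous_image continuous_on_subset[OF f]) auto
  then obtain B where B: "\<And>x. x \<in> {a..b} \<Longrightarrow> norm (f x) \<le> B"
    unfolding bounded_iff by blast
  show ?thesis
  proof (rule integrable_const_bound)
    show "AE x in M. norm (f x) \<le> B"
      using AE by eventually_elim (rule B)
    show "f \<in> borel_measurable M"
      using borel_measurable_continuous_onI[OF f] by (simp add: M_is_borel cong: measurable_cong_sets)
  qed
qed

lemma (in finite_borel_measure) integrable_power_mult:
  fixes f :: "real \<Rightarrow> real"
  assumes AE: "AE x in M. x \<in> {a..b}" and f: "integrable M f"
  shows "integrable M (\<lambda>x. x ^ k * f x)"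
proof (rule Bochner_Integration.integrable_bound)
  show "integrable M (\<lambda>x. (max \<bar>a\<bar> \<bar>b\<bar>) ^ k * f x)"
    using f by simp
  have [measurable]: "f \<in> borel_measurable M" using f by auto
  have [measurable]: "(\<lambda>x. x) \<in> borel_measurable M"
    by (simp add: M_is_borel cong: measurable_cong_sets)
  show "(\<lambda>x. x ^ k * f x) \<in> borel_measurable M"
    by measurable
  show "AE x in M. norm (x ^ k * f x) \<le> norm ((max \<bar>a\<bar> \<bar>b\<bar>) ^ k * f x)"
    using AE
  proof eventually_elim
    case (elim x)
    then have "\<bar>x\<bar> ^ k \<le> \<bar>max \<bar>a\<bar> \<bar>b\<bar>\<bar> ^ k"
      by (intro power_mono) auto
    then show ?case
      by (auto simp: abs_mult power_abs intro: mult_right_mono)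
  qed
qed

lemma (in finite_measure) finite_measure_density_real:
  assumes "integrable M f"
  shows "finite_measure (density M (\<lambda>x. ennreal (f x)))"
proof (rule finite_measureI)
  have [measurable]: "f \<in> borel_measurable M" using assms by auto
  have "emeasure (density M (\<lambda>x. ennreal (f x))) (space M) = (\<integral>\<^sup>+x. ennreal (f x) \<partial>M)"
    by (subst emeasure_density) (auto intro!: nn_integral_cong)
  also have "\<dots> \<le> (\<integral>\<^sup>+x. ennreal (norm (f x)) \<partial>M)"
    by (intro nn_integral_mono ennreal_leI) auto
  also have "\<dots> < \<infinity>"
    using assms by (simp add: integrable_iff_bounded)
  finally show "emeasure (density M (\<lambda>x. ennreal (f x))) (space (density M (\<lambda>x. ennreal (f x)))) \<noteq> \<infinity>"
    by simp
qed

text \<open>Moments fix the integrals of polynomials, by Weierstrass those of continuous functions,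
  in particular of the ramps that pin down the distribution function. Total mass is left free
  because the lemma is also applied to measures given by densities.\<close>

lemma finite_borel_measure_eqI_moments:
  fixes M N :: "real measure"
  assumes "finite_borel_measure M" "finite_borel_measure N"
    and AE: "AE x in M. x \<in> {a..b}" "AE x in N. x \<in> {a..b}"
    and moments: "\<And>k. (\<integral>x. x ^ k \<partial>M) = (\<integral>x. x ^ k \<partial>N)"
  shows "M = N"
proof -
  interpret M: finite_borel_measure M by fact
  interpret N: finite_borel_measure N by fact
  note int = finite_borel_measure.integrable_continuous_AE_Icc
  have eq: "integral\<^sup>L M f = integral\<^sup>L N f" if f: "continuous_on UNIV f" for f :: "real \<Rightarrow> real"
  proof (rule ccontr)
    \<comment> \<open>A uniform error d / C costs at most d / C times the two total masses; the
      extra 1 in C makes this strictly less than d and keeps C positive.\<close>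
    let ?d = "\<bar>integral\<^sup>L M f - integral\<^sup>L N f\<bar>" and ?C = "measure M (space M) + measure N (space N) + 1"
    assume "integral\<^sup>L M f \<noteq> integral\<^sup>L N f"
    moreover have C: "0 < ?C"
      by (simp add: add_nonneg_pos)
    ultimately have "0 < ?d / ?C"
      by simp
    then obtain g where g: "real_polynomial_function g" "\<And>x. x \<in> {a..b} \<Longrightarrow> \<bar>f x - g x\<bar> < ?d / ?C"
      using Stone_Weierstrass_real_polynomial_function[of "{a..b}" f "?d / ?C"] continuous_on_subset[OF f]
      by auto
    obtain c n where gs: "g = (\<lambda>x. \<Sum>i\<le>n. c i * x ^ i)"
      using g(1) by (auto simp: real_polynomial_function_iff_sum)
    have cg: "continuous_on UNIV g"
      unfolding gs by (intro continuous_intros)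
    have "(\<integral>x. x ^ i \<partial>M) = (\<integral>x. x ^ i \<partial>N)" "integrable M (\<lambda>x. x ^ i)" "integrable N (\<lambda>x. x ^ i)" for i
      using moments by (auto intro!: int AE assms continuous_intros)
    then have "integral\<^sup>L M g = integral\<^sup>L N g"
      unfolding gs by simp
    moreover have "\<bar>integral\<^sup>L M f - integral\<^sup>L M g\<bar> \<le> ?d / ?C * measure M (space M)"
      using C by (intro M.integral_uniform_approx int assms AE f cg eventually_mono[OF AE(1)])
        (auto simp: less_imp_le g(2))
    moreover have "\<bar>integral\<^sup>L N f - integral\<^sup>L N g\<bar> \<le> ?d / ?C * measure N (space N)"
      using C by (intro N.integral_uniform_approx int assms AE f cg eventually_mono[OF AE(2)])
        (auto simp: less_imp_le g(2))
    ultimately have "?d \<le> ?d / ?C * (measure M (space M) + measure N (space N))"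
      unfolding distrib_left by linarith
    also have "\<dots> < ?d / ?C * ?C"
      using \<open>0 < ?d / ?C\<close> by (intro mult_strict_left_mono) auto
    finally show False
      using C by simp
  qed
  have "integral\<^sup>L M (cts_step x y) = integral\<^sup>L N (cts_step x y)" if "x < y" for x y
    by (intro eq uniformly_continuous_imp_continuous cts_step_uniformly_continuous that)
  then have "cdf M x = cdf N x" for x
    by (intro antisym cdf_le_if_cts_step_eq assms) auto
  then show ?thesis
    using assms by (intro cdf_unique') auto
qed

text \<open>The positive and negative parts of g, taken as densities, give finite measures with
  equal moments. Determinacy identifies the measures, hence the densities almost everywhere.\<close>

lemma AE_eq_0_if_moments_eq_0:
  fixes M :: "real measure" and g :: "real \<Rightarrow> real"
  assumes M: "finite_borel_measure M" and AE: "AE x in M. x \<in> {a..b}"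
    and g: "integrable M g" and moments: "\<And>k. (\<integral>x. x ^ k * g x \<partial>M) = 0"
  shows "AE x in M. g x = 0"
proof -
  interpret finite_borel_measure M by fact
  have [measurable]: "g \<in> borel_measurable borel"
    using g by (auto dest: borel_measurable_integrable simp: M_is_borel cong: measurable_cong_sets)
  have gM [measurable]: "g \<in> borel_measurable M"
    using g by auto
  have fin: "(\<integral>\<^sup>+x. ennreal (f x) \<partial>M) < \<infinity>" if "integrable M f" for f
  proof -
    have "(\<integral>\<^sup>+x. ennreal (f x) \<partial>M) \<le> (\<integral>\<^sup>+x. ennreal (norm (f x)) \<partial>M)"
      by (intro nn_integral_mono ennreal_leI) auto
    also have "\<dots> < \<infinity>"
      using that by (simp add: integrable_iff_bounded)
    finally show ?thesis .
  qed
  have fbm: "finite_borel_measure (density M (\<lambda>x. ennreal (f x)))" if "integrable M f" for f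
    using finite_measure_density_real[OF that]
    by (simp add: finite_borel_measure_def finite_borel_measure_axioms_def M_is_borel)
  let ?p = "\<lambda>x. max 0 (g x)" and ?n = "\<lambda>x. max 0 (- g x)"
  have pn: "integrable M ?p" "integrable M ?n"
    using g by auto
  note intk = integrable_power_mult[OF AE]
  have "density M (\<lambda>x. ennreal (?p x)) = density M (\<lambda>x. ennreal (?n x))"
  proof (rule finite_borel_measure_eqI_moments[where a = a and b = b])
    fix k
    have [measurable]: "(\<lambda>x. x ^ k) \<in> borel_measurable M"
      by (simp add: M_is_borel cong: measurable_cong_sets)
    have dens: "(\<integral>x. x ^ k \<partial>density M (\<lambda>x. ennreal (f x))) = (\<integral>x. x ^ k * f x \<partial>M)"
      if [measurable]: "f \<in> borel_measurable M" and "\<And>x. 0 \<le> f x" for f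
      by (subst integral_density) (auto simp: that mult.commute)
    have "(\<integral>x. x ^ k \<partial>density M (\<lambda>x. ennreal (?p x))) - (\<integral>x. x ^ k \<partial>density M (\<lambda>x. ennreal (?n x)))
      = (\<integral>x. x ^ k * ?p x \<partial>M) - (\<integral>x. x ^ k * ?n x \<partial>M)"
      by (subst (1 2) dens) auto
    also have "\<dots> = (\<integral>x. x ^ k * ?p x - x ^ k * ?n x \<partial>M)"
      using intk[OF pn(1), of k] intk[OF pn(2), of k] by simp
    also have "\<dots> = (\<integral>x. x ^ k * g x \<partial>M)"
      by (intro Bochner_Integration.integral_cong) (auto simp: max_def)
    finally show "(\<integral>x. x ^ k \<partial>density M (\<lambda>x. ennreal (?p x))) = (\<integral>x. x ^ k \<partial>density M (\<lambda>x. ennreal (?n x)))"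
      using moments by simp
  next
    show "finite_borel_measure (density M (\<lambda>x. ennreal (?p x)))" "finite_borel_measure (density M (\<lambda>x. ennreal (?n x)))"
      by (rule fbm pn)+
  qed (use AE in \<open>auto simp: AE_density\<close>)
  then have "AE x in M. ennreal (?p x) = ennreal (?n x)"
    using fin[OF pn(1)] by (subst (asm) finite_density_unique) auto
  then show ?thesis
    by eventually_elim (auto simp: max_def split: if_splits)
qed

section \<open>The radial distribution and its phase\<close>

text \<open>Here h is the conditional expectation of t given t^2 = x. Only the lower bound is
  recorded; having it for every direction z will bound a modulus.\<close>

lemma odd_part_density:
  fixes \<tau> :: "real measure"
  assumes \<tau>: "real_distribution \<tau>" and AE: "AE t in \<tau>. t \<in> {-m..m}"
  defines "\<kappa> \<equiv> distr \<tau> borel (\<lambda>t. t\<^sup>2)"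
  shows "\<exists>h. integrable \<kappa> h \<and> (AE x in \<kappa>. - sqrt x \<le> h x) \<and> (\<forall>k. (\<integral>x. x ^ k * h x \<partial>\<kappa>) = (\<integral>t. t ^ (2 * k + 1) \<partial>\<tau>))"
proof -
  interpret \<tau>: real_distribution \<tau> by fact
  have rd\<kappa>: "real_distribution \<kappa>"
    unfolding \<kappa>_def by (rule \<tau>.real_distribution_distr) simp
  interpret \<kappa>: real_distribution \<kappa> by fact
  have AE\<kappa>: "AE x in \<kappa>. x \<in> {0..m\<^sup>2}"
    unfolding \<kappa>_def
  proof (subst AE_distr_iff)
    show "AE t in \<tau>. t\<^sup>2 \<in> {0..m\<^sup>2}"
      using AE by eventually_elim (auto simp: abs_le_iff intro!: abs_le_square_iff[THEN iffD1])
  qed auto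
  have int: "integrable \<tau> f" if "continuous_on UNIV f" for f :: "real \<Rightarrow> real"
    by (rule \<tau>.integrable_continuous_AE_Icc[OF AE that])
  have int_pos: "integrable \<tau> (\<lambda>t. max 0 t)"
    by (intro int continuous_intros)
  define D where "D = density \<tau> (\<lambda>t. ennreal (max 0 t))"
  define T where "T = distr D borel (\<lambda>t. t\<^sup>2)"
  interpret D: finite_measure D
    unfolding D_def by (rule \<tau>.finite_measure_density_real[OF int_pos])
  have [simp]: "sets D = sets borel"
    by (simp add: D_def)
  have [measurable_cong]: "sets D = sets borel" "sets T = sets borel" "sets \<kappa> = sets borel"
    by (simp_all add: T_def)
  interpret T: finite_measure T
    unfolding T_def by (rule D.finite_measure_distr) simp
  have "absolutely_continuous \<kappa> T"
    unfolding absolutely_continuous_def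
  proof
    fix A assume "A \<in> null_sets \<kappa>"
    then have A [measurable]: "A \<in> sets borel" and "emeasure \<kappa> A = 0"
      by (auto simp: null_sets_def)
    then have "emeasure \<tau> ((\<lambda>t. t\<^sup>2) -` A \<inter> space \<tau>) = 0"
      by (simp add: \<kappa>_def emeasure_distr)
    moreover have meas: "(\<lambda>t. t\<^sup>2) -` A \<inter> space \<tau> \<in> sets \<tau>"
      by measurable
    ultimately have "AE t in \<tau>. t \<notin> (\<lambda>t. t\<^sup>2) -` A \<inter> space \<tau>"
      by (intro AE_not_in) (auto simp: null_sets_def)
    then have "emeasure D ((\<lambda>t. t\<^sup>2) -` A \<inter> space \<tau>) = 0"
      unfolding D_def using meas
      by (subst emeasure_density) (auto simp: nn_integral_0_iff_AE elim!: eventually_mono)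
    then show "A \<in> null_sets T"
      by (auto simp: null_sets_def T_def emeasure_distr D_def)
  qed
  \<comment> \<open>Only \<open>f \<ge> 0\<close> is used: since \<open>t = 2 max 0 t - \<bar>t\<bar>\<close>, the density sought is \<open>2 f - sqrt\<close>.\<close>
  then obtain f where f [measurable]: "f \<in> borel_measurable \<kappa>" and fT: "density \<kappa> f = T"
    using \<kappa>.Radon_Nikodym[of T] by (auto simp: T_def)
  have "(\<integral>\<^sup>+x. f x \<partial>\<kappa>) = emeasure T (space \<kappa>)"
    unfolding fT[symmetric] by (subst emeasure_density) (auto intro!: nn_integral_cong)
  then have fin: "(\<integral>\<^sup>+x. f x \<partial>\<kappa>) \<noteq> \<infinity>"
    by simp
  then have f_fin: "AE x in \<kappa>. f x \<noteq> \<infinity>"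
    by (intro nn_integral_PInf_AE) auto
  \<comment> \<open>The density takes extended values; finite total mass makes it finite almost
    everywhere, so a real version represents the same measure.\<close>
  define g where "g x = enn2real (f x)" for x
  have [measurable]: "g \<in> borel_measurable borel"
    unfolding g_def by measurable
  have g0: "0 \<le> g x" for x
    by (simp add: g_def)
  have gf: "AE x in \<kappa>. ennreal (g x) = f x"
    using f_fin by eventually_elim (simp add: g_def less_top)
  have gT: "density \<kappa> (\<lambda>x. ennreal (g x)) = T"
    unfolding fT[symmetric] by (rule density_cong) (use gf in auto)
  have "(\<integral>\<^sup>+x. ennreal (g x) \<partial>\<kappa>) = (\<integral>\<^sup>+x. f x \<partial>\<kappa>)"
    by (rule nn_integral_cong_AE) (rule gf)
  then have int_g: "integrable \<kappa> g"
    using fin g0 by (auto simp: integrable_iff_bounded less_top)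
  have int_sqrt: "integrable \<kappa> sqrt"
    by (rule \<kappa>.integrable_continuous_AE_Icc[OF AE\<kappa>]) (intro continuous_intros)
  let ?h = "\<lambda>x. 2 * g x - sqrt x"
  have "(\<integral>x. x ^ k * ?h x \<partial>\<kappa>) = (\<integral>t. t ^ (2 * k + 1) \<partial>\<tau>)" for k
  proof -
    have g_mom: "(\<integral>x. x ^ k * g x \<partial>\<kappa>) = (\<integral>t. t ^ (2 * k) * max 0 t \<partial>\<tau>)"
    proof -
      have "(\<integral>x. x ^ k * g x \<partial>\<kappa>) = (\<integral>x. x ^ k \<partial>T)"
        unfolding gT[symmetric] by (simp add: integral_density g0 mult.commute)
      also have "\<dots> = (\<integral>t. (t\<^sup>2) ^ k \<partial>D)"
        unfolding T_def by (subst integral_distr) auto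
      also have "\<dots> = (\<integral>t. t ^ (2 * k) * max 0 t \<partial>\<tau>)"
        unfolding D_def by (subst integral_density) (auto simp: mult.commute simp flip: power_mult)
      finally show ?thesis .
    qed
    have "(\<integral>x. x ^ k * ?h x \<partial>\<kappa>) = (\<integral>x. 2 * (x ^ k * g x) - x ^ k * sqrt x \<partial>\<kappa>)"
      by (simp add: algebra_simps)
    also have "\<dots> = 2 * (\<integral>x. x ^ k * g x \<partial>\<kappa>) - (\<integral>x. x ^ k * sqrt x \<partial>\<kappa>)"
      using \<kappa>.integrable_power_mult[OF AE\<kappa> int_g, of k] \<kappa>.integrable_power_mult[OF AE\<kappa> int_sqrt, of k]
      by simp
    also have "(\<integral>x. x ^ k * sqrt x \<partial>\<kappa>) = (\<integral>t. t ^ (2 * k) * \<bar>t\<bar> \<partial>\<tau>)"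
      unfolding \<kappa>_def by (subst integral_distr) (auto simp flip: power_mult)
    also have "2 * (\<integral>x. x ^ k * g x \<partial>\<kappa>) - (\<integral>t. t ^ (2 * k) * \<bar>t\<bar> \<partial>\<tau>)
        = (\<integral>t. 2 * (t ^ (2 * k) * max 0 t) - t ^ (2 * k) * \<bar>t\<bar> \<partial>\<tau>)"
      unfolding g_mom by (subst Bochner_Integration.integral_diff) (auto intro!: int continuous_intros)
    also have "\<dots> = (\<integral>t. t ^ (2 * k + 1) \<partial>\<tau>)"
      by (intro Bochner_Integration.integral_cong) (auto simp: max_def)
    finally show ?thesis .
  qed
  then show ?thesis
    using int_g int_sqrt g0 by (intro exI[of _ ?h]) auto
qed

text \<open>The minimum of Re (cis q * w) is - cmod w, at q = pi - Arg w. Rational angles suffice by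
  continuity, and with them only countably many almost-everywhere bounds have to be
  combined.\<close>

lemma cmod_le_if_Re_ge:
  assumes "\<And>q. q \<in> \<rat> \<Longrightarrow> - r \<le> Re (cis q * w)"
  shows "cmod w \<le> r"
proof -
  have "closed {q. - r \<le> Re (cis q * w)}"
    by (intro closed_Collect_le continuous_intros)
  then have "closure \<rat> \<subseteq> {q. - r \<le> Re (cis q * w)}"
    using assms by (intro closure_minimal) auto
  then have "- r \<le> Re (cis (pi - Arg w) * w)"
    unfolding Rats_closure_real by blast
  also have "cis (pi - Arg w) * w = - of_real (cmod w)"
  proof -
    have "w = rcis (cmod w) (Arg w)"
      by (simp add: rcis_cmod_Arg)
    then have "cis (pi - Arg w) * w = of_real (cmod w) * (cis (pi - Arg w) * cis (Arg w))"
      by (metis rcis_def mult.left_commute)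
    then show ?thesis
      by (simp add: cis_mult)
  qed
  finally show ?thesis
    by simp
qed

text \<open>The measure depends on z, but its image under squaring has moments free of z, so
  determinacy gives one common \<kappa>. On it each z yields a real density for the odd moments, and
  these merge into one complex density.\<close>

lemma radial_moment_data:
  fixes s :: "nat \<Rightarrow> complex"
  assumes ex: "\<And>z. cmod z = 1 \<Longrightarrow> \<exists>\<tau>. real_distribution \<tau> \<and> (AE t in \<tau>. t \<in> {-m..m}) \<and>
      (\<forall>k. (\<integral>t. t ^ k \<partial>\<tau>) = Re (if even k then s k else z * s k))"
  shows "\<exists>\<kappa> h. real_distribution \<kappa> \<and> (AE x in \<kappa>. x \<in> {0..m\<^sup>2}) \<and>
      h \<in> borel_measurable borel \<and> (\<forall>x\<ge>0. cmod (h x) \<le> sqrt x) \<and>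
      (\<forall>k. (\<integral>x. x ^ k \<partial>\<kappa>) = Re (s (2 * k))) \<and>
      (\<forall>k. (\<integral>x. of_real (x ^ k) * h x \<partial>\<kappa>) = s (2 * k + 1))"
proof -
  obtain \<tau> where \<tau>: "\<And>z. cmod z = 1 \<Longrightarrow> real_distribution (\<tau> z)"
    and AE\<tau>: "\<And>z. cmod z = 1 \<Longrightarrow> AE t in \<tau> z. t \<in> {-m..m}"
    and mom: "\<And>z k. cmod z = 1 \<Longrightarrow> (\<integral>t. t ^ k \<partial>\<tau> z) = Re (if even k then s k else z * s k)"
    using ex by metis
  define K where "K z = distr (\<tau> z) borel (\<lambda>t. t\<^sup>2)" for z
  have K: "real_distribution (K z)" if "cmod z = 1" for z
    unfolding K_def
    using real_distribution.axioms(1)[OF \<tau>[OF that]] \<tau>[OF that]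
    by (intro prob_space.real_distribution_distr) (auto simp: real_distribution.events_eq_borel cong: measurable_cong_sets)
  have K_mom: "(\<integral>x. x ^ k \<partial>K z) = Re (s (2 * k))" if "cmod z = 1" for z k
  proof -
    interpret real_distribution "\<tau> z" by (rule \<tau>[OF that])
    show ?thesis
      unfolding K_def using mom[OF that, of "2 * k"]
      by (subst integral_distr) (auto simp flip: power_mult)
  qed
  have AE_K: "AE x in K z. x \<in> {0..m\<^sup>2}" if "cmod z = 1" for z
    unfolding K_def
  proof (subst AE_distr_iff)
    interpret real_distribution "\<tau> z" by (rule \<tau>[OF that])
    show "AE t in \<tau> z. t\<^sup>2 \<in> {0..m\<^sup>2}"
      using AE\<tau>[OF that] by eventually_elim (auto simp: abs_le_iff intro!: abs_le_square_iff[THEN iffD1])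
    show "(\<lambda>t. t\<^sup>2) \<in> borel_measurable (\<tau> z)"
      by simp
  qed auto
  define \<kappa> where "\<kappa> = K 1"
  have K_eq: "K z = \<kappa>" if "cmod z = 1" for z
    unfolding \<kappa>_def
    by (rule finite_borel_measure_eqI_moments[OF _ _ AE_K AE_K])
       (use that in \<open>auto simp: K_mom intro!: real_distribution.finite_borel_measure_M K\<close>)
  interpret \<kappa>: real_distribution \<kappa>
    unfolding \<kappa>_def by (rule K) simp
  have AE\<kappa>: "AE x in \<kappa>. x \<in> {0..m\<^sup>2}"
    unfolding \<kappa>_def by (rule AE_K) simp
  have "\<exists>h. integrable \<kappa> h \<and> (AE x in \<kappa>. - sqrt x \<le> h x) \<and> (\<forall>k. (\<integral>x. x ^ k * h x \<partial>\<kappa>) = Re (z * s (2 * k + 1)))"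
    if "cmod z = 1" for z
    using odd_part_density[OF \<tau>[OF that] AE\<tau>[OF that]] mom[OF that, of "2 * k + 1" for k]
    by (simp only: K_eq[OF that, unfolded K_def]) (simp only: odd_two_times_div_two_succ even_plus_one_iff even_mult_iff simp_thms if_False even_numeral odd_add odd_one)
  then obtain h where h_int: "\<And>z. cmod z = 1 \<Longrightarrow> integrable \<kappa> (h z)"
    and h_ge: "\<And>z. cmod z = 1 \<Longrightarrow> AE x in \<kappa>. - sqrt x \<le> h z x"
    and h_mom: "\<And>z k. cmod z = 1 \<Longrightarrow> (\<integral>x. x ^ k * h z x \<partial>\<kappa>) = Re (z * s (2 * k + 1))"
    by metis
  \<comment> \<open>By determinacy \<open>Re (z * H)\<close> equals \<open>h z\<close> for every \<open>z\<close>, and the lower bounds on all \<open>h z\<close> bound \<open>cmod H\<close>.\<close>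
  define H where "H x = of_real (h 1 x) + \<i> * of_real (h (- \<i>) x)" for x
  have [measurable]: "h z \<in> borel_measurable borel" if "cmod z = 1" for z
    using borel_measurable_integrable[OF h_int[OF that]]
    by (simp only: measurable_cong_sets[OF \<kappa>.events_eq_borel refl])
  then have [measurable]: "h 1 \<in> borel_measurable borel" "h (- \<i>) \<in> borel_measurable borel"
    by simp_all
  have [measurable]: "H \<in> borel_measurable borel"
    unfolding H_def by measurable
  have Re_H: "AE x in \<kappa>. - sqrt x \<le> Re (z * H x)" if z: "cmod z = 1" for z
  proof -
    \<comment> \<open>Re (z s) = Re z Re s - Im z Im s and Im s = Re (- \<i> s), so both sides of
      the comparison have the same moments; the directions 1 and - \<i> determine all
      others.\<close>
    have "AE x in \<kappa>. h z x - (Re z * h 1 x - Im z * h (- \<i>) x) = 0"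
    proof (rule AE_eq_0_if_moments_eq_0[OF \<kappa>.finite_borel_measure_M AE\<kappa>])
      show "integrable \<kappa> (\<lambda>x. h z x - (Re z * h 1 x - Im z * h (- \<i>) x))"
        using h_int z by auto
      fix k
      note [simp] = \<kappa>.integrable_power_mult[OF AE\<kappa> h_int[OF z], of k]
        \<kappa>.integrable_power_mult[OF AE\<kappa> h_int, of 1 k, simplified]
        \<kappa>.integrable_power_mult[OF AE\<kappa> h_int, of "- \<i>" k, simplified]
      have "(\<integral>x. x ^ k * (h z x - (Re z * h 1 x - Im z * h (- \<i>) x)) \<partial>\<kappa>)
          = (\<integral>x. x ^ k * h z x - (Re z * (x ^ k * h 1 x) - Im z * (x ^ k * h (- \<i>) x)) \<partial>\<kappa>)"
        by (intro Bochner_Integration.integral_cong) (auto simp: algebra_simps)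
      also have "\<dots> = (\<integral>x. x ^ k * h z x \<partial>\<kappa>) - (Re z * (\<integral>x. x ^ k * h 1 x \<partial>\<kappa>) - Im z * (\<integral>x. x ^ k * h (- \<i>) x \<partial>\<kappa>))"
        by simp
      also have "\<dots> = 0"
        by (simp add: h_mom z)
      finally show "(\<integral>x. x ^ k * (h z x - (Re z * h 1 x - Im z * h (- \<i>) x)) \<partial>\<kappa>) = 0" .
    qed
    with h_ge[OF z] show ?thesis
      by eventually_elim (simp add: H_def)
  qed
  have H_le: "AE x in \<kappa>. cmod (H x) \<le> sqrt x"
  proof -
    have "AE x in \<kappa>. \<forall>q\<in>\<rat>. - sqrt x \<le> Re (cis q * H x)"
      by (subst AE_ball_countable[OF countable_rat]) (intro ballI Re_H norm_cis)
    then show ?thesis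
      by eventually_elim (rule cmod_le_if_Re_ge, blast)
  qed
  \<comment> \<open>Resetting \<open>H\<close> on a null set makes the modulus bound hold at every x
    \<ge> 0 without changing the integrals.\<close>
  define G where "G x = (if cmod (H x) \<le> sqrt x then H x else 0)" for x
  have [measurable]: "G \<in> borel_measurable borel"
    unfolding G_def by measurable
  have "(\<integral>x. of_real (x ^ k) * G x \<partial>\<kappa>) = s (2 * k + 1)" for k
  proof -
    note i = \<kappa>.integrable_power_mult[OF AE\<kappa> h_int, of 1 k, simplified]
        \<kappa>.integrable_power_mult[OF AE\<kappa> h_int, of "- \<i>" k, simplified]
    have "(\<integral>x. of_real (x ^ k) * G x \<partial>\<kappa>) = (\<integral>x. of_real (x ^ k * h 1 x) + \<i> * of_real (x ^ k * h (- \<i>) x) \<partial>\<kappa>)"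
    proof (rule integral_cong_AE)
      show "AE x in \<kappa>. of_real (x ^ k) * G x = of_real (x ^ k * h 1 x) + \<i> * of_real (x ^ k * h (- \<i>) x)"
        using H_le by eventually_elim (simp add: G_def H_def complex_eq_iff)
      show "(\<lambda>x. of_real (x ^ k) * G x) \<in> borel_measurable \<kappa>"
        by measurable
      show "(\<lambda>x. of_real (x ^ k * h 1 x) + \<i> * of_real (x ^ k * h (- \<i>) x)) \<in> borel_measurable \<kappa>"
        using borel_measurable_integrable[OF i(1)] borel_measurable_integrable[OF i(2)] by simp
    qed
    also have "\<dots> = of_real (\<integral>x. x ^ k * h 1 x \<partial>\<kappa>) + \<i> * of_real (\<integral>x. x ^ k * h (- \<i>) x \<partial>\<kappa>)"
      using i by (subst Bochner_Integration.integral_add) (auto simp del: of_real_mult)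
    also have "\<dots> = s (2 * k + 1)"
      by (simp add: h_mom complex_eq_iff)
    finally show ?thesis .
  qed
  moreover have "cmod (G x) \<le> sqrt x" if "0 \<le> x" for x
    using that by (simp add: G_def)
  ultimately show ?thesis
    using AE\<kappa> K_mom[of 1] by (intro exI[of _ \<kappa>] exI[of _ G]) (auto simp: \<kappa>_def K)
qed

section \<open>Realising the barycentre by two opposite masses\<close>

lemma borel_measurable_cis [measurable]: "cis \<in> borel_measurable borel"
  by (intro borel_measurable_continuous_onI continuous_intros)

text \<open>\<open>Arg\<close> is continuous off the nonpositive real axis; on it the values are pi
  and, at the origin, 0.\<close>

lemma borel_measurable_Arg [measurable]: "Arg \<in> borel_measurable borel"
proof -
  have cont: "continuous_on (- \<real>\<^sub>\<le>\<^sub>0) Arg"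
    by (intro continuous_at_imp_continuous_on ballI continuous_at_Arg) simp
  have eq: "Arg = (\<lambda>z. if z = 0 then 0 else if z \<in> - \<real>\<^sub>\<le>\<^sub>0 then Arg z else pi)"
  proof
    fix z
    show "Arg z = (if z = 0 then 0 else if z \<in> - \<real>\<^sub>\<le>\<^sub>0 then Arg z else pi)"
      by (cases "z = 0") (simp add: Arg_zero, auto simp: complex_nonpos_Reals_iff Arg_eq_pi complex_eq_iff)
  qed
  have "(\<lambda>z. if z \<in> - \<real>\<^sub>\<le>\<^sub>0 then Arg z else pi) \<in> borel_measurable borel"
    by (intro borel_measurable_continuous_on_if cont) auto
  then show ?thesis
    by (subst eq) (rule measurable_If, simp_all)
qed

text \<open>
  At distance \<open>r\<close> from the origin put the masses \<open>(1 + \<bar>h\<bar> / r) / 2\<close> and \<open>(1 - \<bar>h\<bar> / r) / 2\<close> at the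
  points in direction \<open>h\<close> and \<open>- h\<close>, so that their barycentre is \<open>h = h(r\<^sup>2)\<close>.
  At \<open>r = 0\<close> the quotient is \<open>0\<close> and both masses are \<open>1 / 2\<close>.
\<close>

lemma exists_symmetric_biradial:
  fixes h :: "real \<Rightarrow> complex"
  assumes \<kappa>: "real_distribution \<kappa>" and AE: "AE x in \<kappa>. x \<in> {0..R}"
    and h [measurable]: "h \<in> borel_measurable borel" and h_le: "\<And>x. 0 \<le> x \<Longrightarrow> cmod (h x) \<le> sqrt x"
  shows "\<exists>\<mu>. symmetric_biradial_measure \<mu> \<and> prob_space \<mu> \<and> sets \<mu> = sets borel \<and>
     (AE z in \<mu>. cmod z \<le> sqrt R) \<and>
     (\<forall>k. (\<integral>z. r2_monom (2 * k) z \<partial>\<mu>) = of_real (\<integral>x. x ^ k \<partial>\<kappa>)) \<and>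
     (\<forall>k. (\<integral>z. r2_monom (2 * k + 1) z \<partial>\<mu>) = (\<integral>x. of_real (x ^ k) * h x \<partial>\<kappa>))"
proof -
  interpret \<kappa>: real_distribution \<kappa> by fact
  \<comment> \<open>\<open>True\<close> stands for the direction of h, \<open>False\<close> for the
    opposite one. The outer maximum acts only at negative x, where no bound on h is given.\<close>
  define w where "w b x = max 0 ((1 + (if b then 1 else - 1) * (cmod (h x) / sqrt x)) / 2)" for b x
  have w_meas [measurable]: "w b \<in> borel_measurable borel" for b
    unfolding w_def by measurable
  have w_nonneg: "0 \<le> w b x" for b x
    by (simp add: w_def)
  have w_sum: "w True x + w False x = 1" and w_diff: "w True x - w False x = cmod (h x) / sqrt x"
    if "0 \<le> x" for x
  proof -
    have "0 \<le> cmod (h x) / sqrt x" "cmod (h x) / sqrt x \<le> 1"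
      using h_le[OF that] that by (auto simp: divide_le_eq_1)
    then show "w True x + w False x = 1" "w True x - w False x = cmod (h x) / sqrt x"
      by (auto simp: w_def max_def field_simps)
  qed
  have w_le: "w b x \<le> 1" if "0 \<le> x" for b x
    using w_sum[OF that] w_nonneg[of True x] w_nonneg[of False x] by (cases b) auto
  define \<phi> where "\<phi> b r = (if b then Arg (h (r\<^sup>2)) else Arg (h (r\<^sup>2)) - pi)" for b r
  have \<phi>_meas [measurable]: "\<phi> b \<in> borel_measurable borel" for b
    unfolding \<phi>_def by measurable
  \<comment> \<open>The absolute value sends the whole line into the half-line, which makes
    \<open>g\<close> a map into \<open>borel_nonneg\<close>; \<kappa> charges only x \<ge>
    0.\<close>
  define g where "g x = sqrt \<bar>x\<bar>" for x :: real
  define \<Phi> where "\<Phi> b r = rcis r (\<phi> b r)" for b r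
  have g_meas [measurable]: "g \<in> borel_measurable borel"
    unfolding g_def by measurable
  have \<Phi>_meas [measurable]: "\<Phi> b \<in> borel_measurable borel" for b
    unfolding \<Phi>_def rcis_def by measurable
  have g_meas' [measurable]: "g \<in> measurable borel borel_nonneg"
    by (rule measurable_restrict_space2) (auto simp: g_def)
  define D where "D b = density \<kappa> (\<lambda>x. ennreal (w b x))" for b
  define \<rho> where "\<rho> b = distr (D b) borel_nonneg g" for b
  \<comment> \<open>\<mu> is built on the product of \<kappa> with two points: (x, b) carries the
    weight \<open>w b x\<close> and is placed at \<open>\<Phi> b (g x)\<close>. A single
    push-forward with Fubini then treats both masses at once.\<close>
  define C where "C = (count_space UNIV :: bool measure)"
  interpret C: sigma_finite_measure C
    unfolding C_def by (rule sigma_finite_measure_count_space_finite) simp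
  interpret P: pair_sigma_finite \<kappa> C ..
  have sets_C [measurable_cong]: "sets C = sets (count_space UNIV)"
    by (simp add: C_def)
  define W where "W = (\<lambda>(x, b). w b x)"
  define \<Psi> where "\<Psi> = (\<lambda>(x, b). \<Phi> b (g x))"
  have W_meas [measurable]: "W \<in> borel_measurable (\<kappa> \<Otimes>\<^sub>M C)"
    unfolding W_def by measurable
  have \<Psi>_meas [measurable]: "\<Psi> \<in> borel_measurable (\<kappa> \<Otimes>\<^sub>M C)"
    unfolding \<Psi>_def by measurable
  have W_nonneg: "0 \<le> W y" for y
    by (auto simp: W_def w_nonneg split: prod.split)
  define \<mu> where "\<mu> = distr (density (\<kappa> \<Otimes>\<^sub>M C) (\<lambda>y. ennreal (W y))) borel \<Psi>"
  have sets_\<mu> [simp, measurable_cong]: "sets \<mu> = sets borel"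
    by (simp add: \<mu>_def)
  have nn: "(\<integral>\<^sup>+z. f z \<partial>\<mu>) = (\<integral>\<^sup>+x. ennreal (w True x) * f (\<Phi> True (g x)) + ennreal (w False x) * f (\<Phi> False (g x)) \<partial>\<kappa>)"
    if f [measurable]: "f \<in> borel_measurable borel" for f
  proof -
    have "(\<integral>\<^sup>+z. f z \<partial>\<mu>) = (\<integral>\<^sup>+y. ennreal (W y) * f (\<Psi> y) \<partial>(\<kappa> \<Otimes>\<^sub>M C))"
      unfolding \<mu>_def by (subst nn_integral_distr) (auto simp: nn_integral_density)
    also have "\<dots> = (\<integral>\<^sup>+x. (\<integral>\<^sup>+b. ennreal (W (x, b)) * f (\<Psi> (x, b)) \<partial>C) \<partial>\<kappa>)"
      by (rule C.nn_integral_fst[symmetric]) measurable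
    finally show ?thesis
      by (simp add: C_def nn_integral_count_space_finite UNIV_bool W_def \<Psi>_def add.commute)
  qed
  have int: "(\<integral>z. f z \<partial>\<mu>) = (\<integral>x. w True x *\<^sub>R f (\<Phi> True (g x)) + w False x *\<^sub>R f (\<Phi> False (g x)) \<partial>\<kappa>)"
    if f: "integrable \<mu> f" for f :: "complex \<Rightarrow> complex"
  proof -
    have [measurable]: "f \<in> borel_measurable borel"
      using borel_measurable_integrable[OF f] by simp
    have i: "integrable (\<kappa> \<Otimes>\<^sub>M C) (\<lambda>y. W y *\<^sub>R f (\<Psi> y))"
      using f unfolding \<mu>_def
      by (subst (asm) integrable_distr_eq) (auto simp: integrable_density W_nonneg)
    have "(\<integral>z. f z \<partial>\<mu>) = (\<integral>y. W y *\<^sub>R f (\<Psi> y) \<partial>(\<kappa> \<Otimes>\<^sub>M C))"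
      unfolding \<mu>_def by (subst integral_distr) (auto simp: integral_density W_nonneg)
    also have "\<dots> = (\<integral>x. (\<integral>b. W (x, b) *\<^sub>R f (\<Psi> (x, b)) \<partial>C) \<partial>\<kappa>)"
      by (rule P.integral_fst'[OF i, symmetric])
    finally show ?thesis
      by (simp add: C_def lebesgue_integral_count_space_finite UNIV_bool W_def \<Psi>_def add.commute)
  qed
  have mass: "(\<integral>\<^sup>+x. ennreal (w True x) + ennreal (w False x) \<partial>\<kappa>) = 1"
  proof -
    have "(\<integral>\<^sup>+x. ennreal (w True x) + ennreal (w False x) \<partial>\<kappa>) = (\<integral>\<^sup>+x. 1 \<partial>\<kappa>)"
    proof (rule nn_integral_cong_AE)
      show "AE x in \<kappa>. ennreal (w True x) + ennreal (w False x) = 1"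
        using AE by eventually_elim (auto simp: w_sum w_nonneg simp flip: ennreal_plus)
    qed
    then show ?thesis
      using \<kappa>.emeasure_space_1 by simp
  qed
  have "emeasure \<mu> (space \<mu>) = 1"
    using nn[of "\<lambda>_. 1"] mass by simp
  then have prob: "prob_space \<mu>"
    by (rule prob_spaceI)
  interpret \<mu>: prob_space \<mu> by (rule prob)
  have \<rho>_eq: "emeasure (\<rho> b) A = (\<integral>\<^sup>+x. ennreal (w b x) * indicator A (g x) \<partial>\<kappa>)"
    if A: "A \<in> sets borel_nonneg" for A b
  proof -
    have [measurable]: "g -` A \<in> sets borel"
      using measurable_sets[OF g_meas' A] by simp
    have "emeasure (\<rho> b) A = emeasure (D b) (g -` A)"
      using A unfolding \<rho>_def by (subst emeasure_distr) (auto simp: D_def)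
    also have "\<dots> = (\<integral>\<^sup>+x. ennreal (w b x) * indicator (g -` A) x \<partial>\<kappa>)"
      unfolding D_def by (rule emeasure_density) auto
    finally show ?thesis
      by (simp add: indicator_def)
  qed
  have rep_sets: "{r \<in> {0..}. \<Phi> b r \<in> E} \<in> sets borel_nonneg" if [measurable]: "E \<in> sets borel" for b E
  proof -
    have "{r. \<Phi> b r \<in> E} \<in> sets borel"
      by measurable
    then show ?thesis
      by (auto simp: sets_restrict_space_iff)
  qed
  \<comment> \<open>This reconciles the product construction with the required sum of two
    transported radial measures.\<close>
  have eq_\<mu>: "emeasure \<mu> E = emeasure (\<rho> True) {r \<in> {0..}. \<Phi> True r \<in> E} + emeasure (\<rho> False) {r \<in> {0..}. \<Phi> False r \<in> E}"
    if E [measurable]: "E \<in> sets borel" for E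
  proof -
    have "emeasure \<mu> E = (\<integral>\<^sup>+z. indicator E z \<partial>\<mu>)"
      by simp
    also have "\<dots> = (\<integral>\<^sup>+x. ennreal (w True x) * indicator E (\<Phi> True (g x)) \<partial>\<kappa>) + (\<integral>\<^sup>+x. ennreal (w False x) * indicator E (\<Phi> False (g x)) \<partial>\<kappa>)"
      by (subst nn) (auto intro!: nn_integral_add)
    also have "(\<lambda>x. indicator E (\<Phi> b (g x)) :: ennreal) = (\<lambda>x. indicator {r \<in> {0..}. \<Phi> b r \<in> E} (g x))" for b
      by (auto simp: indicator_def g_def)
    finally show ?thesis
      unfolding \<rho>_eq[OF rep_sets[OF E]]
      by (auto simp: indicator_def g_def intro!: arg_cong2[where f = "(+)"] nn_integral_cong)
  qed
  have "biradial_representation (\<rho> True) (\<rho> False) (\<phi> True) (\<phi> False) \<mu>"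
    unfolding biradial_representation_def
  proof (intro conjI ballI)
    show "emeasure (\<rho> True) {0..} + emeasure (\<rho> False) {0..} = 1"
      using eq_\<mu>[of UNIV] \<mu>.emeasure_space_1 by (simp add: sets_eq_imp_space_eq[OF sets_\<mu>] atLeast_def)
    have "\<phi> b \<in> borel_measurable borel_nonneg" for b
      by (rule measurable_restrict_space1) simp
    then show "\<phi> True \<in> borel_measurable borel_nonneg" "\<phi> False \<in> borel_measurable borel_nonneg"
      by auto
  qed (auto simp: \<rho>_def eq_\<mu> \<Phi>_def)
  moreover have "[\<phi> True r = \<phi> False r + pi] (rmod (2 * pi))" for r
    by (simp add: \<phi>_def)
  ultimately have "symmetric_biradial_measure \<mu>"
    unfolding symmetric_biradial_measure_def by blast
  moreover have AE\<mu>: "AE z in \<mu>. cmod z \<le> sqrt R"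
  proof -
    have "AE x in \<kappa>. \<forall>b. cmod (\<Phi> b (g x)) \<le> sqrt R"
      using AE by eventually_elim (auto simp: \<Phi>_def g_def)
    then have "(\<integral>\<^sup>+z. indicator {z. \<not> cmod z \<le> sqrt R} z \<partial>\<mu>) = 0"
      by (subst nn) (auto simp: nn_integral_0_iff_AE elim!: eventually_mono)
    then show ?thesis
      by (subst (asm) nn_integral_0_iff_AE) (auto elim!: eventually_mono split: split_indicator_asm)
  qed
  have monom_meas [measurable]: "r2_monom k \<in> borel_measurable borel" for k
    unfolding r2_monom_def by measurable
  have int_monom: "integrable \<mu> (r2_monom k)" for k
  proof (rule \<mu>.integrable_const_bound)
    show "AE z in \<mu>. norm (r2_monom k z) \<le> sqrt R ^ k"
      using AE\<mu>
    proof eventually_elim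
      case (elim z)
      have "norm (r2_monom k z) = cmod z ^ k"
        by (cases k) (auto simp: r2_monom_def norm_mult norm_power)
      then show ?case
        using elim by (simp add: power_mono)
    qed
  qed simp
  have "(\<integral>z. r2_monom (2 * k) z \<partial>\<mu>) = of_real (\<integral>x. x ^ k \<partial>\<kappa>)" for k
  proof -
    have "(\<integral>z. r2_monom (2 * k) z \<partial>\<mu>) = (\<integral>x. of_real (x ^ k) \<partial>\<kappa>)"
    proof (subst int[OF int_monom], rule integral_cong_AE)
      show "AE x in \<kappa>. w True x *\<^sub>R r2_monom (2 * k) (\<Phi> True (g x)) + w False x *\<^sub>R r2_monom (2 * k) (\<Phi> False (g x)) = of_real (x ^ k)"
        using AE
      proof eventually_elim
        case (elim x)
        then have "r2_monom (2 * k) (\<Phi> b (g x)) = of_real (x ^ k)" for b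
          by (auto simp: r2_monom_def \<Phi>_def g_def power_mult)
        then show ?case
          using elim w_sum[of x] by (simp flip: scaleR_left.add)
      qed
    qed measurable
    then show ?thesis
      by (simp only: integral_complex_of_real)
  qed
  moreover have "(\<integral>z. r2_monom (2 * k + 1) z \<partial>\<mu>) = (\<integral>x. of_real (x ^ k) * h x \<partial>\<kappa>)" for k
  proof (subst int[OF int_monom], rule integral_cong_AE)
    show "AE x in \<kappa>. w True x *\<^sub>R r2_monom (2 * k + 1) (\<Phi> True (g x)) + w False x *\<^sub>R r2_monom (2 * k + 1) (\<Phi> False (g x)) = of_real (x ^ k) * h x"
      using AE
    proof eventually_elim
      case (elim x)
      then have x: "0 \<le> x" by simp
      have T: "r2_monom (2 * k + 1) (\<Phi> True (g x)) = of_real (x ^ k) * rcis (sqrt x) (Arg (h x))"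
        using x by (simp add: r2_monom_def \<Phi>_def \<phi>_def g_def power_mult)
      have F: "r2_monom (2 * k + 1) (\<Phi> False (g x)) = - (of_real (x ^ k) * rcis (sqrt x) (Arg (h x)))"
        using x by (simp add: r2_monom_def \<Phi>_def \<phi>_def g_def power_mult rcis_def norm_mult cis_divide[symmetric])
      have "w True x *\<^sub>R r2_monom (2 * k + 1) (\<Phi> True (g x)) + w False x *\<^sub>R r2_monom (2 * k + 1) (\<Phi> False (g x))
          = of_real (x ^ k) * (of_real (w True x - w False x) * rcis (sqrt x) (Arg (h x)))"
        unfolding T F by (simp add: scaleR_conv_of_real algebra_simps)
      also have "of_real (w True x - w False x) * rcis (sqrt x) (Arg (h x)) = h x"
      \<comment> \<open>At x = 0 the modulus bound forces h 0 = 0, so the value of the quotient by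
        \<open>sqrt 0\<close> does no harm.\<close>
      proof (cases "x = 0")
        case True
        then show ?thesis
          using h_le[of 0] by simp
      next
        case False
        then have "of_real (w True x - w False x) * rcis (sqrt x) (Arg (h x)) = rcis (cmod (h x)) (Arg (h x))"
          using x by (simp add: w_diff rcis_def)
        then show ?thesis
          by (simp add: rcis_cmod_Arg)
      qed
      finally show ?case .
    qed
  qed measurable
  ultimately show ?thesis
    using prob AE\<mu> by (intro exI[of _ \<mu>] conjI allI sets_\<mu>)
qed

section \<open>The antilinear Jacobi operator\<close>

definition jacobi_op :: "(nat \<Rightarrow> complex) \<Rightarrow> (nat \<Rightarrow> real) \<Rightarrow> (nat \<Rightarrow> complex) \<Rightarrow> nat \<Rightarrow> complex" where
  "jacobi_op \<alpha> \<beta> f j = \<alpha> (Suc j) * cnj (f j) + of_real (\<beta> (Suc j)) * cnj (f (Suc j)) +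
     (if j = 0 then 0 else of_real (\<beta> j) * cnj (f (j - 1)))"

text \<open>
  Setting \<open>\<beta> (Suc n) = 0\<close> decouples the first \<open>n + 1\<close> coordinates from the others, so that
  the truncated inner product can be used for arbitrary sequences, without any condition
  of finite support or summability.
\<close>

definition trunc_inner :: "nat \<Rightarrow> (nat \<Rightarrow> complex) \<Rightarrow> (nat \<Rightarrow> complex) \<Rightarrow> complex" where
  "trunc_inner N f g = (\<Sum>j<N. f j * cnj (g j))"

lemma trunc_inner_cnj: "cnj (trunc_inner N f g) = trunc_inner N g f"
  by (simp add: trunc_inner_def mult.commute)

lemma trunc_inner_self: "trunc_inner N f f = of_real (\<Sum>j<N. (cmod (f j))\<^sup>2)"
  by (simp only: trunc_inner_def of_real_sum complex_norm_square)

text \<open>An index shift in the subdiagonal terms makes the sum symmetric in f and g; the zero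
  entry removes the boundary term at j = n. The form is conjugate-linear in both arguments, so
  complex \<alpha> do not spoil the symmetry.\<close>

lemma trunc_inner_jacobi_op:
  assumes "\<beta> (Suc n) = 0"
  shows "trunc_inner (Suc n) (jacobi_op \<alpha> \<beta> f) g = (\<Sum>j<Suc n. \<alpha> (Suc j) * cnj (f j) * cnj (g j)) +
    (\<Sum>j<n. of_real (\<beta> (Suc j)) * (cnj (f (Suc j)) * cnj (g j) + cnj (f j) * cnj (g (Suc j))))"
proof -
  have "(\<Sum>j<Suc n. (if j = 0 then 0 else of_real (\<beta> j) * cnj (f (j - 1))) * cnj (g j))
      = (\<Sum>j<n. of_real (\<beta> (Suc j)) * cnj (f j) * cnj (g (Suc j)))"
    by (subst sum.lessThan_Suc_shift) simp
  moreover have "(\<Sum>j<Suc n. of_real (\<beta> (Suc j)) * cnj (f (Suc j)) * cnj (g j))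
      = (\<Sum>j<n. of_real (\<beta> (Suc j)) * cnj (f (Suc j)) * cnj (g j))"
    using assms by simp
  ultimately show ?thesis
    unfolding trunc_inner_def jacobi_op_def distrib_right sum.distrib
    by (simp only: distrib_left sum.distrib mult.assoc add.assoc)
qed

lemma trunc_inner_jacobi_op_sym:
  assumes "\<beta> (Suc n) = 0"
  shows "trunc_inner (Suc n) (jacobi_op \<alpha> \<beta> f) g = trunc_inner (Suc n) (jacobi_op \<alpha> \<beta> g) f"
  unfolding trunc_inner_jacobi_op[where \<beta> = \<beta> and n = n, OF assms] by (simp add: algebra_simps)

text \<open>The diagonal contributes a. Off the diagonal 2 x y \<le> x^2 + y^2, and an index occurs
  in at most two neighbouring pairs, which gives 2 b.\<close>

lemma trunc_inner_jacobi_op_bound: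
  assumes \<beta>0: "\<beta> (Suc n) = 0" and a: "\<And>j. cmod (\<alpha> (Suc j)) \<le> a" and b: "\<And>j. \<bar>\<beta> (Suc j)\<bar> \<le> b"
  shows "cmod (trunc_inner (Suc n) (jacobi_op \<alpha> \<beta> f) f) \<le> (a + 2 * b) * (\<Sum>j<Suc n. (cmod (f j))\<^sup>2)"
proof -
  let ?S = "\<Sum>j<Suc n. (cmod (f j))\<^sup>2"
  have b0: "0 \<le> b"
    using b[of 0] by linarith
  have "cmod (\<Sum>j<Suc n. \<alpha> (Suc j) * cnj (f j) * cnj (f j)) \<le> (\<Sum>j<Suc n. a * (cmod (f j))\<^sup>2)"
  proof (rule sum_norm_le)
    fix j
    show "cmod (\<alpha> (Suc j) * cnj (f j) * cnj (f j)) \<le> a * (cmod (f j))\<^sup>2"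
      using mult_right_mono[OF a[of j], of "(cmod (f j))\<^sup>2"]
      by (simp add: norm_mult power2_eq_square mult.assoc)
  qed
  moreover have "cmod (\<Sum>j<n. of_real (\<beta> (Suc j)) * (cnj (f (Suc j)) * cnj (f j) + cnj (f j) * cnj (f (Suc j))))
      \<le> (\<Sum>j<n. b * ((cmod (f j))\<^sup>2 + (cmod (f (Suc j)))\<^sup>2))"
  proof (rule sum_norm_le)
    fix j
    have "cmod (of_real (\<beta> (Suc j)) * (cnj (f (Suc j)) * cnj (f j) + cnj (f j) * cnj (f (Suc j))))
        = \<bar>\<beta> (Suc j)\<bar> * (2 * cmod (f j) * cmod (f (Suc j)))"
      by (simp add: norm_mult mult.commute flip: mult_2)
    also have "\<dots> \<le> b * ((cmod (f j))\<^sup>2 + (cmod (f (Suc j)))\<^sup>2)"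
      using b[of j] b0 by (intro mult_mono sum_squares_bound) auto
    finally show "cmod (of_real (\<beta> (Suc j)) * (cnj (f (Suc j)) * cnj (f j) + cnj (f j) * cnj (f (Suc j))))
        \<le> b * ((cmod (f j))\<^sup>2 + (cmod (f (Suc j)))\<^sup>2)" .
  qed
  moreover have "(\<Sum>j<n. b * ((cmod (f j))\<^sup>2 + (cmod (f (Suc j)))\<^sup>2)) \<le> b * (?S + ?S)"
  proof -
    have "(\<Sum>j<n. (cmod (f j))\<^sup>2) \<le> ?S"
      by simp
    moreover have "(\<Sum>j<n. (cmod (f (Suc j)))\<^sup>2) \<le> ?S"
      by (subst sum.lessThan_Suc_shift) simp
    ultimately show ?thesis
      unfolding sum_distrib_left[symmetric] sum.distrib using b0 by (intro mult_left_mono add_mono) auto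
  qed
  ultimately show ?thesis
    unfolding trunc_inner_jacobi_op[where \<beta> = \<beta> and n = n, OF \<beta>0]
    by (intro order.trans[OF norm_triangle_ineq]) (simp add: sum_distrib_left[symmetric] algebra_simps)
qed

text \<open>The vector p(A) v. The coefficients are real because an antilinear map commutes with
  real scalars only.\<close>

definition op_poly :: "((nat \<Rightarrow> complex) \<Rightarrow> nat \<Rightarrow> complex) \<Rightarrow> (nat \<Rightarrow> complex) \<Rightarrow> real poly \<Rightarrow> nat \<Rightarrow> complex" where
  "op_poly A v p j = (\<Sum>k\<le>degree p. of_real (coeff p k) * (A ^^ k) v j)"

lemma op_poly_altdef:
  "degree p \<le> n \<Longrightarrow> op_poly A v p j = (\<Sum>k\<le>n. of_real (coeff p k) * (A ^^ k) v j)"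
  unfolding op_poly_def by (rule sum.mono_neutral_left) (auto simp: coeff_eq_0)

lemma op_poly_add: "op_poly A v (p + q) j = op_poly A v p j + op_poly A v q j"
  using op_poly_altdef[of p "max (degree p) (degree q)"] op_poly_altdef[of q "max (degree p) (degree q)"]
    op_poly_altdef[of "p + q" "max (degree p) (degree q)"] degree_add_le_max[of p q]
  by (simp add: sum.distrib ring_distribs)

lemma op_poly_smult: "op_poly A v (smult c p) j = of_real c * op_poly A v p j"
  using op_poly_altdef[of "smult c p" "degree p"] degree_smult_le[of c p]
  by (simp add: op_poly_def sum_distrib_left mult.assoc)

lemma op_poly_0: "op_poly A v 0 j = 0"
  by (simp add: op_poly_def)

lemma op_poly_const: "op_poly A v [:c:] j = of_real c * v j"
  by (simp add: op_poly_def)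

lemma jacobi_op_sum:
  "jacobi_op \<alpha> \<beta> (\<lambda>j. \<Sum>k\<in>K. of_real (c k) * f k j) j = (\<Sum>k\<in>K. of_real (c k) * jacobi_op \<alpha> \<beta> (f k) j)"
  by (simp add: jacobi_op_def sum_distrib_left sum.distrib ring_distribs mult.left_commute)

lemma op_poly_pCons_0:
  "op_poly (jacobi_op \<alpha> \<beta>) v (pCons 0 p) j = jacobi_op \<alpha> \<beta> (op_poly (jacobi_op \<alpha> \<beta>) v p) j"
proof -
  let ?A = "jacobi_op \<alpha> \<beta>"
  have "op_poly ?A v (pCons 0 p) j = (\<Sum>k\<le>Suc (degree p). of_real (coeff (pCons 0 p) k) * (?A ^^ k) v j)"
    by (rule op_poly_altdef) (rule degree_pCons_le)
  also have "\<dots> = (\<Sum>k\<le>degree p. of_real (coeff p k) * ?A ((?A ^^ k) v) j)"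
    by (subst sum.atMost_Suc_shift) simp
  finally show ?thesis
    by (simp add: jacobi_op_sum op_poly_def[abs_def])
qed

text \<open>p(A) is symmetric for the real inner product; the induction moves one factor A across at
  a time. Real parts are what makes the pairing symmetric in its arguments.\<close>

lemma Re_trunc_inner_op_poly_mult:
  fixes \<alpha> v
  assumes \<beta>0: "\<beta> (Suc n) = 0"
  defines "F \<equiv> op_poly (jacobi_op \<alpha> \<beta>) v"
  shows "Re (trunc_inner (Suc n) (F p) (F q)) = Re (trunc_inner (Suc n) (F (p * q)) v)"
proof (induction p arbitrary: q)
  case 0
  show ?case
    by (simp add: F_def op_poly_0 trunc_inner_def)
next
  case (pCons a p)
  let ?R = "\<lambda>f g. Re (trunc_inner (Suc n) f g)" and ?A = "jacobi_op \<alpha> \<beta>"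
  have sym: "?R f g = ?R g f" for f g
    using trunc_inner_cnj[of "Suc n" f g] by (metis complex_cnj(1) cnj.sel(1))
  have lin: "?R (\<lambda>j. of_real c * f j + g j) h = c * ?R f h + ?R g h" for c f g h
    by (simp add: trunc_inner_def sum_distrib_left sum.distrib algebra_simps)
  have cons: "F (pCons a p) = (\<lambda>j. of_real a * v j + ?A (F p) j)" for a p
  proof
    fix j
    have "F (pCons a p) j = F ([:a:] + pCons 0 p) j"
      by simp
    then show "F (pCons a p) j = of_real a * v j + ?A (F p) j"
      by (simp only: F_def op_poly_add op_poly_const op_poly_pCons_0)
  qed
  have shift: "F (pCons 0 p) = ?A (F p)" for p
    by (simp add: cons)
  have "F (pCons a p * q) = F (smult a q + pCons 0 (p * q))"
    by simp
  also have "\<dots> = (\<lambda>j. of_real a * F q j + F (p * pCons 0 q) j)"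
    by (simp add: F_def op_poly_add op_poly_smult fun_eq_iff)
  finally have "?R (F (pCons a p * q)) v = a * ?R (F q) v + ?R (F p) (F (pCons 0 q))"
    by (simp only: lin pCons.IH)
  also have "?R (F p) (F (pCons 0 q)) = ?R (?A (F p)) (F q)"
    unfolding shift sym[of "F p"] by (rule arg_cong[where f = Re], rule trunc_inner_jacobi_op_sym[where \<beta> = \<beta> and n = n, OF \<beta>0])
  finally show ?case
    unfolding cons lin sym[of v] by simp
qed

lemma jacobi_op_iter_support:
  "j > k \<Longrightarrow> (jacobi_op \<alpha> \<beta> ^^ k) (\<lambda>j. if j = 0 then w else 0) j = 0"
  by (induction k arbitrary: j) (auto simp: jacobi_op_def)

lemma jacobi_op_iter_phase:
  "(jacobi_op \<alpha> \<beta> ^^ k) (\<lambda>j. if j = 0 then w else 0) j =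
     (if even k then w else cnj w) * (jacobi_op \<alpha> \<beta> ^^ k) (\<lambda>j. if j = 0 then 1 else 0) j"
  by (induction k arbitrary: j) (auto simp: jacobi_op_def algebra_simps)

lemma jacobi_op_trunc_cong:
  assumes "\<And>i. i \<le> n \<Longrightarrow> f i = g i" "g (Suc n) = 0" "j \<le> n"
  shows "jacobi_op \<alpha> (\<beta>(Suc n := 0)) f j = jacobi_op \<alpha> \<beta> g j"
  using assms by (cases "j = n") (auto simp: jacobi_op_def)

text \<open>Starting at coordinate 0, k \<le> n iterations do not reach coordinate n + 1, so on the
  first n + 1 coordinates the deleted entry would only have multiplied zeros.\<close>

lemma jacobi_op_iter_trunc:
  assumes "k \<le> n" "j \<le> n"
  shows "(jacobi_op \<alpha> (\<beta>(Suc n := 0)) ^^ k) (\<lambda>j. if j = 0 then w else 0) j =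
    (jacobi_op \<alpha> \<beta> ^^ k) (\<lambda>j. if j = 0 then w else 0) j"
  using assms
proof (induction k arbitrary: j)
  case (Suc k)
  let ?v = "\<lambda>j. if j = 0 then w else 0"
  have "(jacobi_op \<alpha> \<beta> ^^ k) ?v (Suc n) = 0"
    using Suc.prems by (intro jacobi_op_iter_support) simp
  moreover have "(jacobi_op \<alpha> (\<beta>(Suc n := 0)) ^^ k) ?v i = (jacobi_op \<alpha> \<beta> ^^ k) ?v i" if "i \<le> n" for i
    by (rule Suc.IH) (use Suc.prems that in auto)
  ultimately show ?case
    unfolding funpow.simps o_apply by (intro jacobi_op_trunc_cong Suc.prems)
qed simp

text \<open>With u = p(A) v the quantity is m <u, u> + e Re <A u, u>, and the form of A is bounded
  by (a + 2 b) <u, u>. The two signs of e are the positivity conditions at the ends of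
  [-m, m].\<close>

lemma Re_trunc_inner_op_poly_nonneg:
  assumes \<beta>0: "\<beta> (Suc n) = 0" and a: "\<And>j. cmod (\<alpha> (Suc j)) \<le> a" and b: "\<And>j. \<bar>\<beta> (Suc j)\<bar> \<le> b"
    and m: "a + 2 * b \<le> m" and e: "\<bar>e\<bar> = 1"
  shows "0 \<le> Re (trunc_inner (Suc n) (op_poly (jacobi_op \<alpha> \<beta>) v ([:m,e:] * p\<^sup>2)) v)"
proof -
  let ?A = "jacobi_op \<alpha> \<beta>" and ?R = "\<lambda>f g. Re (trunc_inner (Suc n) f g)"
  let ?F = "op_poly ?A v"
  let ?S = "\<Sum>j<Suc n. (cmod (?F p j))\<^sup>2"
  have "[:m,e:] * p\<^sup>2 = (smult m p + smult e (pCons 0 p)) * p"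
    by (simp add: power2_eq_square algebra_simps)
  then have "?R (?F ([:m,e:] * p\<^sup>2)) v = ?R (?F (smult m p + smult e (pCons 0 p))) (?F p)"
    by (simp only: Re_trunc_inner_op_poly_mult[of \<beta> n \<alpha> v, OF \<beta>0])
  also have "?F (smult m p + smult e (pCons 0 p)) = (\<lambda>j. of_real m * ?F p j + of_real e * ?A (?F p) j)"
    by (simp only: op_poly_add op_poly_smult op_poly_pCons_0 fun_eq_iff simp_thms)
  also have "?R (\<lambda>j. of_real m * ?F p j + of_real e * ?A (?F p) j) (?F p) = m * ?R (?F p) (?F p) + e * ?R (?A (?F p)) (?F p)"
    by (simp add: trunc_inner_def sum_distrib_left sum.distrib algebra_simps)
  also have "?R (?F p) (?F p) = ?S"
    by (simp only: trunc_inner_self Re_complex_of_real)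
  finally have eq: "?R (?F ([:m,e:] * p\<^sup>2)) v = m * ?S + e * ?R (?A (?F p)) (?F p)" .
  have "\<bar>e * ?R (?A (?F p)) (?F p)\<bar> \<le> cmod (trunc_inner (Suc n) (?A (?F p)) (?F p))"
    using e abs_Re_le_cmod by (simp add: abs_mult)
  also have "\<dots> \<le> (a + 2 * b) * ?S"
    by (intro trunc_inner_jacobi_op_bound \<beta>0 a b)
  also have "\<dots> \<le> m * ?S"
    by (rule mult_right_mono[OF m]) (simp add: sum_nonneg)
  finally show ?thesis
    unfolding eq by linarith
qed

text \<open>
  The coordinates of \<open>\<langle>\<lambda>\<rangle>\<^sup>k\<close> in the basis of the polynomials \<open>p\<^sub>j\<close> to be constructed; the
  0-th one must be the integral of \<open>\<langle>\<lambda>\<rangle>\<^sup>k\<close>.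
\<close>

definition jacobi_vec :: "(nat \<Rightarrow> complex) \<Rightarrow> (nat \<Rightarrow> real) \<Rightarrow> nat \<Rightarrow> nat \<Rightarrow> complex" where
  "jacobi_vec \<alpha> \<beta> k = (jacobi_op \<alpha> \<beta> ^^ k) (\<lambda>j. if j = 0 then 1 else 0)"

text \<open>The square of the antilinear symmetric operator is linear and self-adjoint for the
  complex inner product, so <A^(2k) e_0, e_0> is real. The radial measure supplies only real parts
  of even moments, hence the need for this.\<close>

lemma jacobi_vec_even_real: "Im (jacobi_vec \<alpha> \<beta> (2 * k) 0) = 0"
proof -
  let ?A = "jacobi_op \<alpha> (\<beta>(Suc (2 * k) := 0))" and ?N = "Suc (2 * k)" and ?e = "\<lambda>j. if j = 0 then 1 else 0 :: complex"
  have sym: "trunc_inner ?N (?A f) g = trunc_inner ?N (?A g) f" for f g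
    by (rule trunc_inner_jacobi_op_sym) simp
  \<comment> \<open><A A f, g> = <A g, A f>, and the conjugate <A f, A g> of the latter equals <A A
    g, f>.\<close>
  have sym2: "trunc_inner ?N (?A (?A f)) g = trunc_inner ?N f (?A (?A g))" for f g
    by (metis sym trunc_inner_cnj)
  have "trunc_inner ?N ((?A ^^ (2 * i)) f) g = trunc_inner ?N f ((?A ^^ (2 * i)) g)" for i f g
  proof (induction i arbitrary: g)
    case (Suc i)
    have "(?A ^^ (2 * Suc i)) f = ?A (?A ((?A ^^ (2 * i)) f))" "(?A ^^ (2 * Suc i)) g = (?A ^^ (2 * i)) (?A (?A g))"
      by (simp_all add: funpow_swap1)
    then show ?case
      by (simp only: sym2 Suc.IH)
  qed simp
  then have eq: "trunc_inner ?N ((?A ^^ (2 * k)) ?e) ?e = cnj (trunc_inner ?N ((?A ^^ (2 * k)) ?e) ?e)"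
    by (simp only: trunc_inner_cnj)
  have "trunc_inner ?N ((?A ^^ (2 * k)) ?e) ?e = (?A ^^ (2 * k)) ?e 0"
    unfolding trunc_inner_def by (subst sum.lessThan_Suc_shift) simp
  also have "\<dots> = jacobi_vec \<alpha> \<beta> (2 * k) 0"
    unfolding jacobi_vec_def by (rule jacobi_op_iter_trunc) auto
  finally show ?thesis
    using eq by (simp add: complex_eq_iff)
qed

text \<open>
  The unit vector \<open>w e\<^sub>0\<close> is used, with \<open>z = (cnj w)\<^sup>2\<close>: in \<open>\<langle>A\<^sup>k w e\<^sub>0, w e\<^sub>0\<rangle>\<close> the phase \<open>w\<close> cancels
  for even \<open>k\<close> and contributes the factor \<open>z\<close> for odd \<open>k\<close>, the operator being antilinear.
\<close>

lemma jacobi_rotated_moments: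
  assumes a: "\<And>j. cmod (\<alpha> (Suc j)) \<le> a" and b: "\<And>j. \<bar>\<beta> (Suc j)\<bar> \<le> b"
    and m: "a + 2 * b \<le> m" "0 < m" and z: "cmod z = 1"
  shows "\<exists>\<tau>. real_distribution \<tau> \<and> (AE t in \<tau>. t \<in> {-m..m}) \<and>
    (\<forall>k. (\<integral>t. t ^ k \<partial>\<tau>) = Re (if even k then jacobi_vec \<alpha> \<beta> k 0 else z * jacobi_vec \<alpha> \<beta> k 0))"
proof -
  define w where "w = cnj (csqrt z)"
  have cw: "(cnj w)\<^sup>2 = z"
    by (simp add: w_def)
  have "(cmod w)\<^sup>2 = 1"
    using z by (simp add: w_def flip: norm_power)
  then have wn: "w * cnj w = 1"
    by (simp add: complex_norm_square[symmetric])
  let ?v = "\<lambda>j. if j = 0 then w else 0" and ?A = "jacobi_op \<alpha> \<beta>"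
  define L where "L p = Re (op_poly ?A ?v p 0 * cnj w)" for p
  \<comment> \<open>The functional is defined without truncation; the cut-off n is chosen for each
    polynomial separately, at least its degree.\<close>
  have L_trunc: "L p = Re (trunc_inner (Suc n) (op_poly (jacobi_op \<alpha> (\<beta>(Suc n := 0))) ?v p) ?v)"
    if "degree p \<le> n" for p n
  proof -
    have "trunc_inner (Suc n) (op_poly (jacobi_op \<alpha> (\<beta>(Suc n := 0))) ?v p) ?v
        = op_poly (jacobi_op \<alpha> (\<beta>(Suc n := 0))) ?v p 0 * cnj w"
      unfolding trunc_inner_def by (subst sum.lessThan_Suc_shift) simp
    also have "op_poly (jacobi_op \<alpha> (\<beta>(Suc n := 0))) ?v p 0 = op_poly ?A ?v p 0"
      unfolding op_poly_def using that
      by (intro sum.cong) (auto simp: jacobi_op_iter_trunc)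
    finally show ?thesis
      by (simp only: L_def)
  qed
  have pos: "0 \<le> L ([:m,e:] * p\<^sup>2)" if "\<bar>e\<bar> = 1" for e p
  proof (subst L_trunc[OF order_refl], rule Re_trunc_inner_op_poly_nonneg)
    let ?n = "degree ([:m,e:] * p\<^sup>2)"
    show "\<bar>(\<beta>(Suc ?n := 0)) (Suc j)\<bar> \<le> b" for j
      using b[of j] by auto
  qed (use a m that in auto)
  have "\<exists>\<tau>. real_distribution \<tau> \<and> (AE t in \<tau>. t \<in> {-m..m}) \<and> (\<forall>p. (\<integral>t. poly p t \<partial>\<tau>) = L p)"
  proof (rule interval_moment_problem[OF _ _ _ m(2)])
    fix p q :: "real poly" and c :: real
    show "L (p + q) = L p + L q" "L (smult c p) = c * L p"
      by (simp_all add: L_def op_poly_add op_poly_smult algebra_simps)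
    show "L 1 = 1"
      using wn by (simp add: L_def one_pCons op_poly_const)
    show "0 \<le> L ([:m,1:] * p\<^sup>2)" "0 \<le> L ([:m,-1:] * p\<^sup>2)"
      by (rule pos, simp)+
  qed
  then obtain \<tau> where \<tau>: "real_distribution \<tau>" "AE t in \<tau>. t \<in> {-m..m}" "\<And>p. (\<integral>t. poly p t \<partial>\<tau>) = L p"
    by blast
  have "(\<integral>t. t ^ k \<partial>\<tau>) = Re (if even k then jacobi_vec \<alpha> \<beta> k 0 else z * jacobi_vec \<alpha> \<beta> k 0)" for k
  proof -
    have "(\<integral>t. t ^ k \<partial>\<tau>) = L (monom 1 k)"
      using \<tau>(3)[of "monom 1 k"] by (simp add: poly_monom)
    also have "\<dots> = Re ((if even k then w else cnj w) * cnj w * jacobi_vec \<alpha> \<beta> k 0)"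
    proof -
      have "op_poly ?A ?v (monom 1 k) 0 = (?A ^^ k) ?v 0"
        by (simp add: op_poly_altdef[of _ k] degree_monom_le if_distrib[of of_real] if_distrib[of "\<lambda>x. x * _"] cong: if_cong)
      then show ?thesis
        unfolding L_def jacobi_op_iter_phase[where w = w] jacobi_vec_def by (simp only: mult_ac)
    qed
    also have "(if even k then w else cnj w) * cnj w = (if even k then 1 else z)"
      by (simp add: wn flip: cw power2_eq_square)
    finally show ?thesis
      by simp
  qed
  with \<tau> show ?thesis
    by blast
qed

section \<open>Orthonormal polynomials\<close>

lemma r2_fun_altdef: "degree p \<le> n \<Longrightarrow> r2_fun p z = (\<Sum>k\<le>n. coeff p k * r2_monom k z)"
  unfolding r2_fun_def by (rule sum.mono_neutral_left) (auto simp: coeff_eq_0)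

lemma r2_fun_add: "r2_fun (p + q) z = r2_fun p z + r2_fun q z"
  using r2_fun_altdef[of p "max (degree p) (degree q)"] r2_fun_altdef[of q "max (degree p) (degree q)"]
    r2_fun_altdef[of "p + q" "max (degree p) (degree q)"] degree_add_le_max[of p q]
  by (simp add: sum.distrib ring_distribs)

lemma r2_fun_smult: "r2_fun (smult c p) z = c * r2_fun p z"
  using r2_fun_altdef[of "smult c p" "degree p"] degree_smult_le[of c p]
  by (simp add: r2_fun_def sum_distrib_left mult.assoc)

lemma r2_fun_0: "r2_fun 0 z = 0"
  by (simp add: r2_fun_def r2_monom_def)

lemma r2_fun_1: "r2_fun 1 z = 1"
  by (simp add: r2_fun_def r2_monom_def)

lemma r2_fun_monom: "r2_fun (monom 1 k) = r2_monom k"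
  by (simp add: fun_eq_iff r2_fun_altdef[of _ k] degree_monom_le if_distrib[of "\<lambda>x. x * _"] cong: if_cong)

text \<open>For odd k the product z * cnj z restores an even power of the modulus, for even k the
  factor z remains: the monomials are the iterates of f -> z * cnj f on 1.\<close>

lemma r2_monom_Suc: "r2_monom (Suc k) z = z * cnj (r2_monom k z)"
proof -
  have "z * cnj z = of_real (cmod z) * of_real (cmod z)"
    by (simp flip: complex_norm_square add: power2_eq_square)
  then show ?thesis
    by (cases k) (auto simp: r2_monom_def simp flip: mult.assoc)
qed

definition r2_inner :: "complex measure \<Rightarrow> complex poly \<Rightarrow> complex poly \<Rightarrow> complex" where
  "r2_inner \<mu> p q = L2_inner \<mu> (r2_fun p) (r2_fun q)"

text \<open>The map f -> z * cnj f, read in coefficients.\<close>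

definition conj_shift :: "complex poly \<Rightarrow> complex poly" where
  "conj_shift p = pCons 0 (map_poly cnj p)"

lemma coeff_conj_shift: "coeff (conj_shift p) k = (case k of 0 \<Rightarrow> 0 | Suc k \<Rightarrow> cnj (coeff p k))"
  by (simp add: conj_shift_def coeff_pCons coeff_map_poly split: nat.split)

lemma conj_shift_add: "conj_shift (p + q) = conj_shift p + conj_shift q"
  by (rule poly_eqI) (simp add: coeff_conj_shift split: nat.split)

lemma conj_shift_smult: "conj_shift (smult c p) = smult (cnj c) (conj_shift p)"
  by (rule poly_eqI) (simp add: coeff_conj_shift split: nat.split)

lemma conj_shift_0: "conj_shift 0 = 0"
  by (simp add: conj_shift_def)

lemma conj_shift_sum: "conj_shift (sum f S) = (\<Sum>i\<in>S. conj_shift (f i))"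
  by (induction S rule: infinite_finite_induct) (auto simp: conj_shift_add conj_shift_0)

lemma conj_shift_monom: "conj_shift (monom 1 k) = monom 1 (Suc k)"
  by (rule poly_eqI) (simp add: coeff_conj_shift split: nat.split)

lemma r2_fun_conj_shift: "r2_fun (conj_shift p) z = z * cnj (r2_fun p z)"
proof -
  have "degree (conj_shift p) \<le> Suc (degree p)"
    by (rule degree_le) (auto simp: coeff_conj_shift coeff_eq_0 split: nat.split)
  then have "r2_fun (conj_shift p) z = (\<Sum>k\<le>Suc (degree p). coeff (conj_shift p) k * r2_monom k z)"
    by (rule r2_fun_altdef)
  also have "\<dots> = (\<Sum>k\<le>degree p. cnj (coeff p k) * (z * cnj (r2_monom k z)))"
    by (subst sum.atMost_Suc_shift) (simp add: coeff_conj_shift r2_monom_Suc)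
  finally show ?thesis
    by (simp add: r2_fun_def sum_distrib_left mult_ac)
qed

text \<open>The recursion taken as a definition, with no measure involved; agreement with the
  Gram-Schmidt polynomials is proved later.\<close>

fun jacobi_poly :: "(nat \<Rightarrow> complex) \<Rightarrow> (nat \<Rightarrow> real) \<Rightarrow> nat \<Rightarrow> complex poly" where
  "jacobi_poly \<alpha> \<beta> 0 = 1"
| "jacobi_poly \<alpha> \<beta> (Suc j) = smult (of_real (1 / \<beta> (Suc j)))
     (conj_shift (jacobi_poly \<alpha> \<beta> j) - smult (\<alpha> (Suc j)) (jacobi_poly \<alpha> \<beta> j) -
      (if j = 0 then 0 else smult (of_real (\<beta> j)) (jacobi_poly \<alpha> \<beta> (j - 1))))"

context
  fixes \<alpha> :: "nat \<Rightarrow> complex" and \<beta> :: "nat \<Rightarrow> real"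
  assumes \<beta>_pos: "\<And>j. 0 < \<beta> (Suc j)"
begin

private abbreviation P :: "nat \<Rightarrow> complex poly" where
  "P \<equiv> jacobi_poly \<alpha> \<beta>"

private abbreviation E :: "nat \<Rightarrow> nat \<Rightarrow> complex" where
  "E \<equiv> jacobi_vec \<alpha> \<beta>"

lemma conj_shift_jacobi_poly:
  "conj_shift (P j) = smult (of_real (\<beta> (Suc j))) (P (Suc j)) + smult (\<alpha> (Suc j)) (P j) +
     (if j = 0 then 0 else smult (of_real (\<beta> j)) (P (j - 1)))"
proof -
  have "complex_of_real (\<beta> (Suc j)) * of_real (1 / \<beta> (Suc j)) = 1"
    using \<beta>_pos[of j] by (simp flip: of_real_mult)
  then show ?thesis
    by (simp only: jacobi_poly.simps smult_smult smult_1_left) simp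
qed

lemma jacobi_vec_0: "E 0 j = (if j = 0 then 1 else 0)"
  by (simp add: jacobi_vec_def)

lemma jacobi_vec_Suc: "E (Suc k) = jacobi_op \<alpha> \<beta> (E k)"
  by (simp add: jacobi_vec_def)

lemma jacobi_vec_eq_0: "k < j \<Longrightarrow> E k j = 0"
  unfolding jacobi_vec_def by (rule jacobi_op_iter_support)

lemma jacobi_vec_diag: "E k k = of_real (\<Prod>j<k. \<beta> (Suc j))"
  by (induction k) (auto simp: jacobi_vec_0 jacobi_vec_Suc jacobi_op_def jacobi_vec_eq_0)

text \<open>When z * cnj is applied to the expansion of the k-th monomial, the three-term relation
  collects at \<open>P j\<close> the j-th entry of \<open>jacobi_op\<close> applied to
  \<open>E k\<close>.\<close>

lemma monom_eq_sum_jacobi_poly: "monom 1 k = (\<Sum>j\<le>k. smult (E k j) (P j))"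
proof (induction k)
  case 0
  show ?case
    by (simp add: jacobi_vec_0 monom_0 one_pCons)
next
  case (Suc k)
  let ?b = "\<lambda>j. of_real (\<beta> j) :: complex"
  have "monom 1 (Suc k) = (\<Sum>j\<le>k. smult (cnj (E k j)) (conj_shift (P j)))"
    by (simp only: conj_shift_monom[symmetric] Suc.IH conj_shift_sum conj_shift_smult)
  also have "\<dots> = (\<Sum>j\<le>k. smult (cnj (E k j) * ?b (Suc j)) (P (Suc j))) + (\<Sum>j\<le>k. smult (cnj (E k j) * \<alpha> (Suc j)) (P j))
      + (\<Sum>j\<le>k. if j = 0 then 0 else smult (cnj (E k j) * ?b j) (P (j - 1)))"
    unfolding conj_shift_jacobi_poly sum.distrib[symmetric]
    by (intro sum.cong refl) (simp add: smult_add_right del: jacobi_poly.simps)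
  \<comment> \<open>All three sums are brought to the range up to \<open>Suc k\<close>, indexed by
    the polynomial; the added terms vanish, by the case distinction at 0 or because E k j = 0 for j
    > k.\<close>
  also have "(\<Sum>j\<le>k. smult (cnj (E k j) * ?b (Suc j)) (P (Suc j)))
      = (\<Sum>j\<le>Suc k. if j = 0 then 0 else smult (cnj (E k (j - 1)) * ?b j) (P j))"
    by (subst sum.atMost_Suc_shift) (simp del: jacobi_poly.simps)
  also have "(\<Sum>j\<le>k. smult (cnj (E k j) * \<alpha> (Suc j)) (P j)) = (\<Sum>j\<le>Suc k. smult (cnj (E k j) * \<alpha> (Suc j)) (P j))"
    by (simp add: jacobi_vec_eq_0 del: jacobi_poly.simps)
  also have "(\<Sum>j\<le>k. if j = 0 then 0 else smult (cnj (E k j) * ?b j) (P (j - 1)))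
      = (\<Sum>j\<le>Suc (Suc k). if j = 0 then 0 else smult (cnj (E k j) * ?b j) (P (j - 1)))"
    by (simp add: jacobi_vec_eq_0 del: jacobi_poly.simps)
  also have "\<dots> = (\<Sum>j\<le>Suc k. smult (cnj (E k (Suc j)) * ?b (Suc j)) (P j))"
    by (subst sum.atMost_Suc_shift) (simp del: jacobi_poly.simps sum.atMost_Suc)
  finally show ?case
    unfolding sum.distrib[symmetric]
    by (simp add: jacobi_vec_Suc jacobi_op_def smult_add_left mult_ac add_ac if_distrib[of "\<lambda>c. smult c _"]
        cong: if_cong del: jacobi_poly.simps sum.atMost_Suc)
qed

lemma poly_eq_sum_jacobi_poly:
  obtains c n where "p = (\<Sum>j\<le>n. smult (c j) (P j))"
proof
  have "p = (\<Sum>k\<le>degree p. smult (coeff p k) (monom 1 k))"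
    using poly_as_sum_of_monoms[of p] by (simp add: smult_monom)
  also have "\<dots> = (\<Sum>k\<le>degree p. \<Sum>j\<le>degree p. smult (coeff p k * E k j) (P j))"
  proof (intro sum.cong refl)
    fix k assume "k \<in> {..degree p}"
    then have "(\<Sum>j\<le>degree p. smult (E k j) (P j)) = (\<Sum>j\<le>k. smult (E k j) (P j))"
      by (intro sum.mono_neutral_right) (auto simp: jacobi_vec_eq_0)
    then show "smult (coeff p k) (monom 1 k) = (\<Sum>j\<le>degree p. smult (coeff p k * E k j) (P j))"
      by (simp only: monom_eq_sum_jacobi_poly smult_sum_right[symmetric] smult_smult[symmetric])
  qed
  also have "\<dots> = (\<Sum>j\<le>degree p. \<Sum>k\<le>degree p. smult (coeff p k * E k j) (P j))"
    by (rule sum.swap)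
  finally show "p = (\<Sum>j\<le>degree p. smult (\<Sum>k\<le>degree p. coeff p k * E k j) (P j))"
    by (simp only: smult_sum)
qed

section \<open>Orthonormality for a measure with the prescribed moments\<close>

context
  fixes \<mu> :: "complex measure" and R :: real
  assumes prob: "prob_space \<mu>" and sets_\<mu>: "sets \<mu> = sets borel"
    and bounded: "AE z in \<mu>. cmod z \<le> R"
    and moments: "\<And>k. (\<integral>z. r2_monom k z \<partial>\<mu>) = E k 0"
begin

interpretation prob_space \<mu> by (rule prob)

lemma borel_measurable_r2_fun: "r2_fun p \<in> borel_measurable \<mu>"
proof -
  have "r2_monom k \<in> borel_measurable \<mu>" for k
    unfolding measurable_cong_sets[OF sets_\<mu> refl] r2_monom_def by measurable
  then show ?thesis
    unfolding r2_fun_def[abs_def] by measurable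
qed

lemma AE_r2_fun_bounded: "\<exists>B. AE z in \<mu>. cmod (r2_fun p z) \<le> B"
proof
  show "AE z in \<mu>. cmod (r2_fun p z) \<le> (\<Sum>k\<le>degree p. cmod (coeff p k) * R ^ k)"
    using bounded
  proof eventually_elim
    case (elim z)
    have "cmod (r2_monom k z) = cmod z ^ k" for k
      by (cases k) (auto simp: r2_monom_def norm_mult norm_power)
    then have "cmod (coeff p k * r2_monom k z) \<le> cmod (coeff p k) * R ^ k" for k
      using elim by (simp add: norm_mult mult_left_mono power_mono)
    then show ?case
      unfolding r2_fun_def by (rule sum_norm_le)
  qed
qed

lemma integrable_r2_fun_mult: "integrable \<mu> (\<lambda>z. r2_fun p z * cnj (r2_fun q z))"
proof -
  note [measurable] = borel_measurable_r2_fun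
  obtain B C where BC: "AE z in \<mu>. cmod (r2_fun p z) \<le> B" "AE z in \<mu>. cmod (r2_fun q z) \<le> C"
    using AE_r2_fun_bounded by blast
  show ?thesis
  proof (rule integrable_const_bound)
    show "AE z in \<mu>. norm (r2_fun p z * cnj (r2_fun q z)) \<le> B * C"
      using BC
    proof eventually_elim
      case (elim z)
      then show ?case
        using order_trans[OF norm_ge_zero elim(1)] by (simp add: norm_mult mult_mono)
    qed
    have "(\<lambda>z. cnj (r2_fun q z)) \<in> borel_measurable \<mu>"
      by (rule borel_measurable_continuous_on[OF _ borel_measurable_r2_fun]) (intro continuous_intros)
    then show "(\<lambda>z. r2_fun p z * cnj (r2_fun q z)) \<in> borel_measurable \<mu>"
      by measurable
  qed
qed

private abbreviation B :: "complex poly \<Rightarrow> complex poly \<Rightarrow> complex" where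
  "B \<equiv> r2_inner \<mu>"

lemma r2_inner_add: "B (p + q) r = B p r + B q r"
  using integrable_r2_fun_mult[of p r] integrable_r2_fun_mult[of q r]
  by (simp add: r2_inner_def L2_inner_def r2_fun_add distrib_right)

lemma r2_inner_smult: "B (smult c p) r = c * B p r"
  by (simp add: r2_inner_def L2_inner_def r2_fun_smult mult.assoc)

lemma r2_inner_0: "B 0 r = 0"
  by (simp add: r2_inner_def L2_inner_def r2_fun_0)

lemma r2_inner_sum: "B (sum f S) r = (\<Sum>i\<in>S. B (f i) r)"
  by (induction S rule: infinite_finite_induct) (auto simp: r2_inner_add r2_inner_0)

lemma r2_inner_cnj: "cnj (B p q) = B q p"
  unfolding r2_inner_def L2_inner_def
  by (subst Bochner_Integration.integral_cnj[symmetric]) (simp add: mult.commute)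

text \<open>Both sides integrate z * cnj p * cnj q: the counterpart for \<mu> of the symmetry of the
  Jacobi operator.\<close>

lemma r2_inner_conj_shift: "B (conj_shift p) q = B (conj_shift q) p"
  by (simp add: r2_inner_def L2_inner_def r2_fun_conj_shift mult_ac)

lemma r2_inner_1: "B p 1 = (\<integral>z. r2_fun p z \<partial>\<mu>)"
  by (simp add: r2_inner_def L2_inner_def r2_fun_1)

text \<open>For j > 0, integrating the expansion of the j-th monomial gives E j 0. By induction the
  term k = 0 already accounts for it and those with 0 < k < j vanish; what remains is E j j B (P j)
  1 = 0 with E j j nonzero.\<close>

lemma r2_inner_jacobi_poly_1: "B (P j) 1 = (if j = 0 then 1 else 0)"
proof (induction j rule: less_induct)
  case (less j)
  show ?case
  proof (cases j)
    case 0
    then show ?thesis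
      by (simp add: r2_inner_1 r2_fun_1 prob_space)
  next
    case (Suc i)
    have "E j 0 = B (monom 1 j) 1"
      by (simp add: r2_inner_1 r2_fun_monom moments)
    also have "\<dots> = (\<Sum>k\<le>j. E j k * B (P k) 1)"
      by (simp only: monom_eq_sum_jacobi_poly r2_inner_sum r2_inner_smult)
    also have "\<dots> = (\<Sum>k<j. E j k * B (P k) 1) + E j j * B (P j) 1"
      by (simp only: lessThan_Suc_atMost[symmetric] sum.lessThan_Suc)
    also have "(\<Sum>k<j. E j k * B (P k) 1) = (\<Sum>k<j. if k = 0 then E j 0 else 0)"
      by (rule sum.cong) (auto simp: less.IH)
    also have "\<dots> = E j 0"
      using Suc by (simp add: sum.delta)
    finally have "E j j * B (P j) 1 = 0"
      by simp
    moreover have "E j j \<noteq> 0"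
      using \<beta>_pos by (auto simp: jacobi_vec_diag less_imp_neq[symmetric] simp del: of_real_prod)
    ultimately show ?thesis
      using Suc by simp
  qed
qed

text \<open>Induction on the second index k = i + 1: both sides of <z cnj P_i, P_j> = <z cnj P_j,
  P_i> are expanded by the three-term relation. Every product except <P_k, P_j> involves P_i or
  P_(i-1) and is known.\<close>

lemma r2_inner_jacobi_poly: "B (P j) (P k) = (if j = k then 1 else 0)"
proof (induction k arbitrary: j rule: less_induct)
  case (less k)
  show ?case
  proof (cases k)
    case 0
    then show ?thesis
      by (simp add: r2_inner_jacobi_poly_1)
  next
    case (Suc i)
    let ?b = "\<lambda>j. of_real (\<beta> j) :: complex"
    have IH: "B (P j) (P i) = (if j = i then 1 else 0)" for j
      using less.IH[of i] Suc by simp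
    have "B (P i) (P j) = (if j = i then 1 else 0)"
      using IH[of j] r2_inner_cnj[of "P j" "P i"] by (simp split: if_splits)
    moreover have "(if i = 0 then 0 else ?b i * B (P (i - 1)) (P j)) = (if Suc j = i then ?b i else 0)"
    proof (cases i)
      case (Suc l)
      then show ?thesis
        using less.IH[of l j] \<open>k = Suc i\<close> r2_inner_cnj[of "P j" "P l"] by (auto split: if_splits)
    qed simp
    moreover have "B (conj_shift (P i)) (P j) = ?b k * B (P k) (P j) + \<alpha> k * B (P i) (P j) + (if i = 0 then 0 else ?b i * B (P (i - 1)) (P j))"
      by (simp add: conj_shift_jacobi_poly r2_inner_add r2_inner_smult r2_inner_0 Suc del: jacobi_poly.simps)
    ultimately have "B (conj_shift (P i)) (P j) = ?b k * B (P k) (P j) + \<alpha> k * (if j = i then 1 else 0) + (if Suc j = i then ?b i else 0)"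
      by (simp only:)
    moreover have "B (conj_shift (P i)) (P j) = ?b (Suc j) * B (P (Suc j)) (P i) + \<alpha> (Suc j) * B (P j) (P i) + (if j = 0 then 0 else ?b j * B (P (j - 1)) (P i))"
      by (subst r2_inner_conj_shift) (simp add: conj_shift_jacobi_poly r2_inner_add r2_inner_smult r2_inner_0 del: jacobi_poly.simps)
    ultimately have "?b k * B (P k) (P j) + \<alpha> k * (if j = i then 1 else 0) + (if Suc j = i then ?b i else 0)
        = ?b (Suc j) * (if Suc j = i then 1 else 0) + \<alpha> (Suc j) * (if j = i then 1 else 0) + (if j = 0 then 0 else ?b j * (if j - 1 = i then 1 else 0))"
      by (simp only: IH)
    then have "?b k * B (P k) (P j) = ?b k * (if j = k then 1 else 0)"
      using Suc by (cases j) (auto simp del: jacobi_poly.simps split: if_splits)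
    moreover have "?b k \<noteq> 0"
      using \<beta>_pos[of i] Suc by simp
    ultimately have "B (P k) (P j) = (if j = k then 1 else 0)"
      by (metis mult_left_cancel)
    then show ?thesis
      using r2_inner_cnj[of "P k" "P j"] by (simp split: if_splits)
  qed
qed

text \<open>Removing the components along the earlier polynomials leaves E n n P_n. Being a product
  of positive \<beta>, E n n is also the norm of this remainder, so normalising leaves exactly P_n,
  without a phase.\<close>

lemma r2_orthonormal_eq_jacobi_poly: "r2_orthonormal \<mu> n = P n"
proof (induction n rule: less_induct)
  case (less n)
  let ?c = "\<Prod>j<n. \<beta> (Suc j)"
  have c: "0 < ?c"
    by (rule prod_pos) (simp add: \<beta>_pos)
  have inner: "L2_inner \<mu> (r2_monom n) (r2_fun (P i)) = E n i" for i
  proof -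
    have "L2_inner \<mu> (r2_monom n) (r2_fun (P i)) = B (monom 1 n) (P i)"
      by (simp add: r2_inner_def r2_fun_monom)
    also have "\<dots> = (\<Sum>j\<le>n. E n j * (if j = i then 1 else 0))"
      by (simp only: monom_eq_sum_jacobi_poly r2_inner_sum r2_inner_smult r2_inner_jacobi_poly)
    also have "\<dots> = E n i"
      by (simp add: if_distrib[of "\<lambda>x. _ * x"] jacobi_vec_eq_0 cong: if_cong)
    finally show ?thesis .
  qed
  define q where "q = monom 1 n -
            (\<Sum>i<n. smult (L2_inner \<mu> (r2_monom n) (r2_fun (r2_orthonormal \<mu> i))) (r2_orthonormal \<mu> i))"
  have "q = monom 1 n - (\<Sum>i<n. smult (E n i) (P i))"
    unfolding q_def by (intro arg_cong2[where f = "(-)"] sum.cong refl) (simp add: less.IH inner)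
  also have "monom 1 n = (\<Sum>i<n. smult (E n i) (P i)) + smult (E n n) (P n)"
    by (simp only: monom_eq_sum_jacobi_poly lessThan_Suc_atMost[symmetric] sum.lessThan_Suc)
  finally have q: "q = smult (of_real ?c) (P n)"
    by (simp add: jacobi_vec_diag)
  have norm: "L2_norm \<mu> (r2_fun q) = ?c"
  proof -
    have "of_real (\<integral>z. (cmod (r2_fun q z))\<^sup>2 \<partial>\<mu>) = B q q"
      by (simp only: r2_inner_def L2_inner_def complex_norm_square[symmetric] integral_complex_of_real)
    also have "\<dots> = of_real ?c * B (P n) q"
      by (simp only: q r2_inner_smult)
    also have "B (P n) q = cnj (of_real ?c * B (P n) (P n))"
      by (subst r2_inner_cnj[symmetric]) (simp only: q r2_inner_smult)
    also have "of_real ?c * cnj (of_real ?c * B (P n) (P n)) = of_real (?c\<^sup>2)"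
      by (simp only: r2_inner_jacobi_poly if_True mult_1_right complex_cnj_complex_of_real power2_eq_square of_real_mult simp_thms)
    finally show ?thesis
      using c unfolding L2_norm_def of_real_eq_iff by simp
  qed
  have "smult (of_real (1 / L2_norm \<mu> (r2_fun q))) q = smult (of_real (1 / ?c * ?c)) (P n)"
    unfolding norm by (simp only: q smult_smult of_real_mult)
  also have "1 / ?c * ?c = 1"
    using less_imp_neq[OF c] by (metis nonzero_eq_divide_eq)
  finally have "smult (of_real (1 / L2_norm \<mu> (r2_fun q))) q = P n"
    by simp
  then show ?case
    by (subst r2_orthonormal.simps) (simp add: q_def Let_def)
qed

text \<open>Coefficients in the basis \<open>P\<close> are inner products with an orthonormal
  family, so they vanish for a polynomial that is zero almost everywhere: this is independence. The
  parameters are read off from the three-term relation.\<close>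

lemma has_Jacobi_parametersI: "has_Jacobi_parameters \<mu> \<alpha> \<beta>"
proof -
  have shift: "L2_inner \<mu> (\<lambda>z. z * cnj (r2_fun (P j) z)) (r2_fun q) = B (conj_shift (P j)) q" for j q
    by (simp add: r2_inner_def r2_fun_conj_shift[abs_def])
  have "r2_independent \<mu>"
    unfolding r2_independent_def
  proof (intro allI impI)
    fix p assume AE: "AE z in \<mu>. r2_fun p z = 0"
    obtain c n where p: "p = (\<Sum>j\<le>n. smult (c j) (P j))"
      by (rule poly_eq_sum_jacobi_poly)
    have "c k = 0" if "k \<le> n" for k
    proof -
      have "c k = (\<Sum>j\<le>n. c j * (if j = k then 1 else 0))"
        using that by (simp add: if_distrib[of "\<lambda>x. _ * x"] cong: if_cong)
      also have "\<dots> = B p (P k)"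
        by (simp only: p r2_inner_sum r2_inner_smult r2_inner_jacobi_poly)
      also have "\<dots> = 0"
        unfolding r2_inner_def L2_inner_def using AE by (intro integral_eq_zero_AE) (auto elim: eventually_mono)
      finally show ?thesis .
    qed
    then show "p = 0"
      by (simp add: p)
  qed
  moreover have "integrable \<mu> (\<lambda>z. cmod z ^ n)" for n
  proof (rule integrable_const_bound)
    show "AE z in \<mu>. norm (cmod z ^ n) \<le> R ^ n"
      using bounded by eventually_elim (simp add: power_mono)
    show "(\<lambda>z. cmod z ^ n) \<in> borel_measurable \<mu>"
      unfolding measurable_cong_sets[OF sets_\<mu> refl] by measurable
  qed
  moreover have "\<alpha> (Suc j) = B (conj_shift (P j)) (P j)" "of_real (\<beta> (Suc j)) = B (conj_shift (P j)) (P (Suc j))" for j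
    by (auto simp: conj_shift_jacobi_poly r2_inner_add r2_inner_smult r2_inner_0 r2_inner_jacobi_poly simp del: jacobi_poly.simps)
  moreover have "of_real (\<beta> (Suc j)) * r2_fun (P (Suc j)) z = z * cnj (r2_fun (P j) z) - \<alpha> (Suc j) * r2_fun (P j) z -
      (if j = 0 then 0 else of_real (\<beta> j) * r2_fun (P (j - 1)) z)" for j z
    unfolding r2_fun_conj_shift[symmetric] conj_shift_jacobi_poly
    by (simp add: r2_fun_add r2_fun_smult r2_fun_0 del: jacobi_poly.simps)
  ultimately show ?thesis
    unfolding has_Jacobi_parameters_def Let_def r2_orthonormal_eq_jacobi_poly
    by (simp add: prob sets_\<mu> shift del: jacobi_poly.simps)
qed

end

end

theorem theorem3p13:
  fixes \<alpha> :: "nat \<Rightarrow> complex" and \<beta> :: "nat \<Rightarrow> real"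
  assumes "bounded (\<alpha> ` {1..})"
    and "bounded (\<beta> ` {1..})"
    and "\<forall>j\<ge>1. 0 < \<beta> j"
  shows "\<exists>\<mu>. symmetric_biradial_measure \<mu> \<and> compactly_supported \<mu> \<and> has_Jacobi_parameters \<mu> \<alpha> \<beta>"
proof -
  obtain a b where "\<forall>x\<in>\<alpha> ` {1..}. cmod x \<le> a" "\<forall>x\<in>\<beta> ` {1..}. \<bar>x\<bar> \<le> b"
    using assms(1,2) unfolding bounded_iff real_norm_def by blast
  then have ab: "\<And>j. cmod (\<alpha> (Suc j)) \<le> a" "\<And>j. \<bar>\<beta> (Suc j)\<bar> \<le> b"
    by simp_all
  \<comment> \<open>The maximum with 1 provides the positive radius that the affine change of
    variable divides by.\<close>
  define m where "m = max 1 (a + 2 * b)"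
  have m: "a + 2 * b \<le> m" "0 < m"
    by (auto simp: m_def)
  let ?E = "\<lambda>k. jacobi_vec \<alpha> \<beta> k 0"
  obtain \<kappa> h where \<kappa>: "real_distribution \<kappa>" "AE x in \<kappa>. x \<in> {0..m\<^sup>2}"
    and h: "h \<in> borel_measurable borel" "\<And>x. 0 \<le> x \<Longrightarrow> cmod (h x) \<le> sqrt x"
    and even: "\<And>k. (\<integral>x. x ^ k \<partial>\<kappa>) = Re (?E (2 * k))"
    and odd: "\<And>k. (\<integral>x. of_real (x ^ k) * h x \<partial>\<kappa>) = ?E (2 * k + 1)"
    using radial_moment_data[OF jacobi_rotated_moments[of \<alpha> a \<beta> b, OF ab m]] by blast
  obtain \<mu> where \<mu>: "symmetric_biradial_measure \<mu>" "prob_space \<mu>" "sets \<mu> = sets borel"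
    and AE: "AE z in \<mu>. cmod z \<le> sqrt (m\<^sup>2)"
    and mom: "\<And>k. (\<integral>z. r2_monom (2 * k) z \<partial>\<mu>) = of_real (\<integral>x. x ^ k \<partial>\<kappa>)"
      "\<And>k. (\<integral>z. r2_monom (2 * k + 1) z \<partial>\<mu>) = (\<integral>x. of_real (x ^ k) * h x \<partial>\<kappa>)"
    using exists_symmetric_biradial[OF \<kappa> h] by blast
  have moments: "(\<integral>z. r2_monom k z \<partial>\<mu>) = ?E k" for k
  proof (cases "even k")
    case True
    then obtain i where "k = 2 * i" ..
    then show ?thesis
      using jacobi_vec_even_real[of \<alpha> \<beta> i] by (simp add: mom(1) even complex_eq_iff)
  next
    case False
    then obtain i where "k = 2 * i + 1" ..
    then show ?thesis
      using mom(2)[of i] odd[of i] by simp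
  qed
  have "compactly_supported \<mu>"
    unfolding compactly_supported_def
  proof (intro exI conjI)
    show "emeasure \<mu> (- cball 0 (sqrt (m\<^sup>2))) = 0"
      using AE by (subst (asm) AE_iff_measurable[of "- cball 0 (sqrt (m\<^sup>2))"])
        (auto simp: \<mu>(3) sets_eq_imp_space_eq[OF \<mu>(3)])
  qed simp
  moreover have "has_Jacobi_parameters \<mu> \<alpha> \<beta>"
    by (rule has_Jacobi_parametersI[OF _ \<mu>(2,3) AE moments]) (use assms(3) in auto)
  ultimately show ?thesis
    using \<mu>(1) by blast
qed

end
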